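(* Let $X,Y$ be infinite-dimensional complex Hilbert spaces, let $W\in\mathcal{B}(Y,X)\setminus\{0\}$, let $A\in\mathcal{B}(X,Y)$ be $W$g-Drazin invertible and let $B\in\mathcal{B}(X,Y)$. Then the following statements are equivalent: (i) $A\leq^{\otimes,W,l}B$; (ii) $WA(WA)^{\otimes}=WB(WA)^{\otimes}$ and $(WA)^{\otimes}WA=(WA)^{\otimes}WB$; (iii) $WAWA^{\otimes,W}=WBWA^{\otimes,W}$ and $WA^{\otimes,W}WA=WA^{\otimes,W}WB$; (iv) the following matrix representations with respect to the orthogonal sums $X=R((WA)^d)\oplus N[((WA)^d)^*]$ and $Y=R((AW)^d)\oplus N[((AW)^d)^*]$ hold: $$A=\begin{bmatrix}A_1&A_2\\0&A_3\end{bmatrix},\quad W=\begin{bmatrix}W_1&W_2\\0&W_3\end{bmatrix},\quad B=\begin{bmatrix}A_1-W_1^{-1}W_2B_4&B_2\\ B_4&B_3\end{bmatrix},$$ where $A_1\in\mathcal{B}(R((WA)^d),R((AW)^d))$ and $W_1\in\mathcal{B}(R((AW)^d),R((WA)^d))$ are invertible, $W_3B_4=0$, $B_2=A_2+W_1^{-1}W_2(A_3-B_3)+(W_1A_1W_1)^{-1}(W_1A_2+W_2A_3)W_3(A_3-B_3)$, and $A_3W_3\in\mathcal{B}(N[((AW)^d)^*])$ and $W_3A_3\in\mathcal{B}(N[((WA)^d)^*])$ are quasinilpotent.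
   Context: $\mathcal{B}(X,Y)$ is the set of bounded linear operators from $X$ to $Y$, $\mathcal{B}(X)=\mathcal{B}(X,X)$; $R(\cdot)$, $N(\cdot)$, $(\cdot)^*$ denote range, null space and adjoint; $P_L$ is the orthogonal projector onto a closed subspace $L$. An operator $T\in\mathcal{B}(X)$ is generalized Drazin invertible if there is a (necessarily unique) $T^d\in\mathcal{B}(X)$ with $TT^d=T^dT$, $T^dTT^d=T^d$ and $T-T^2T^d$ quasinilpotent (and similarly on $Y$). For $W\in\mathcal{B}(Y,X)\setminus\{0\}$, an operator $A\in\mathcal{B}(X,Y)$ is $W$g-Drazin invertible if there is a (necessarily unique) $A^{d,W}=B\in\mathcal{B}(X,Y)$ with $AWB=BWA$, $BWAWB=B$ and $A-AWBWA$ quasinilpotent in the weighted sense, i.e. $(A-AWBWA)W$ is a quasinilpotent operator on $Y$. In that case $AW$ and $WA$ are generalized Drazin invertible with $(AW)^d=A^{d,W}W$ and $(WA)^d=WA^{d,W}$. If $A$ is $W$g-Drazin invertible, its weighted core-EP inverse $A^{\mathrm{cEP},W}$ is the unique (it exists) operator $B\in\mathcal{B}(X,Y)$ with $WAWB=P_{R((WA)^d)}$ and $R(B)\subseteq R((AW)^d)$; the weighted weak group inverse of $A$ is $A^{\otimes,W}=(A^{\mathrm{cEP},W}W)^2A$. For a generalized Drazin invertible operator $T$ on a Hilbert space, the core-EP inverse $T^{\mathrm{cEP}}$ is the unique (it exists) operator $B$ with $TB=P_{R(T^d)}$ and $R(B)\subseteq R(T^d)$, and the weak group inverse of $T$ is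 $T^{\otimes}=(T^{\mathrm{cEP}})^2T$. Weak group relation: for $T$ generalized Drazin invertible and $S$ bounded on the same Hilbert space, $T\leq^{\otimes}S$ means $TT^{\otimes}=ST^{\otimes}$ and $T^{\otimes}T=T^{\otimes}S$. For $A,B\in\mathcal{B}(X,Y)$ with $A$ $W$g-Drazin invertible, $A\leq^{\otimes,W,l}B$ means $WA\leq^{\otimes}WB$. *)

theory Defs
  imports "HOL-Analysis.Analysis"
begin

section \<open>Complex Hilbert spaces\<close>

text \<open>The inner product is linear in its first argument and conjugate-linear in its second.\<close>

class complex_inner = real_normed_vector +
  fixes scaleC :: "complex \<Rightarrow> 'a \<Rightarrow> 'a"  (infixr \<open>*\<^sub>C\<close> 75)
    and cinner :: "'a \<Rightarrow> 'a \<Rightarrow> complex"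
  assumes scaleR_scaleC: "scaleR r x = complex_of_real r *\<^sub>C x"
    and scaleC_add_right: "a *\<^sub>C (x + y) = a *\<^sub>C x + a *\<^sub>C y"
    and scaleC_add_left: "(a + b) *\<^sub>C x = a *\<^sub>C x + b *\<^sub>C x"
    and scaleC_scaleC: "a *\<^sub>C b *\<^sub>C x = (a * b) *\<^sub>C x"
    and scaleC_one: "1 *\<^sub>C x = x"
    and cinner_commute: "cinner x y = cnj (cinner y x)"
    and cinner_add_left: "cinner (x + y) z = cinner x z + cinner y z"
    and cinner_scaleC_left: "cinner (a *\<^sub>C x) y = a * cinner x y"
    and cinner_self: "cinner x x = complex_of_real ((norm x)\<^sup>2)"

class chilbert_space = complex_inner + complete_space

global_interpretation complex_vector: vector_space "scaleC :: complex \<Rightarrow> 'a \<Rightarrow> 'a::complex_inner"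
  defines csubspace = complex_vector.subspace
    and cspan = complex_vector.span
  by standard (simp_all add: scaleC_add_right scaleC_add_left scaleC_scaleC scaleC_one)

definition infinite_dimensional :: "'a::complex_inner set \<Rightarrow> bool" where
  "infinite_dimensional U \<longleftrightarrow> \<not> (\<exists>S. finite S \<and> S \<subseteq> U \<and> U \<subseteq> cspan S)"

definition orthogonal_sum :: "'a::complex_inner set \<Rightarrow> 'a set \<Rightarrow> bool" where
  "orthogonal_sum U V \<longleftrightarrow> csubspace U \<and> csubspace V \<and>
     (\<forall>u\<in>U. \<forall>v\<in>V. cinner u v = 0) \<and> (\<forall>x. \<exists>u\<in>U. \<exists>v\<in>V. x = u + v)"

definition proj :: "'a::complex_inner set \<Rightarrow> 'a \<Rightarrow> 'a" where
  "proj L x = (THE y. y \<in> L \<and> (\<forall>z\<in>L. cinner (x - y) z = 0))"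


section \<open>Bounded operators\<close>

text \<open>
  Operators between (closed) subspaces are represented by functions on the ambient types.
  For \<open>T \<in> bop U V\<close> the values of \<open>T\<close> outside \<open>U\<close> are irrelevant; all notions below only
  look at the values on \<open>U\<close>. The bounded operators between the full spaces are
  \<open>bop UNIV UNIV\<close>.
\<close>

definition bop :: "'a::complex_inner set \<Rightarrow> 'b::complex_inner set \<Rightarrow> ('a \<Rightarrow> 'b) set" where
  "bop U V = {T. (\<forall>x\<in>U. T x \<in> V) \<and>
     (\<forall>x\<in>U. \<forall>y\<in>U. T (x + y) = T x + T y) \<and>
     (\<forall>c. \<forall>x\<in>U. T (c *\<^sub>C x) = c *\<^sub>C T x) \<and>
     (\<exists>K. \<forall>x\<in>U. norm (T x) \<le> norm x * K)}"

lemma bop_UNIV_iff: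
  "T \<in> bop UNIV UNIV \<longleftrightarrow> bounded_linear T \<and> (\<forall>c x. T (c *\<^sub>C x) = c *\<^sub>C T x)"
  unfolding bop_def bounded_linear_def bounded_linear_axioms_def linear_iff
  by (auto simp: scaleR_scaleC)

definition invertible_bop :: "'a::complex_inner set \<Rightarrow> 'b::complex_inner set \<Rightarrow> ('a \<Rightarrow> 'b) \<Rightarrow> bool" where
  "invertible_bop U V T \<longleftrightarrow> T \<in> bop U V \<and> bij_betw T U V \<and> inv_into U T \<in> bop V U"

definition spectrum :: "'a::complex_inner set \<Rightarrow> ('a \<Rightarrow> 'a) \<Rightarrow> complex set" where
  "spectrum U T = {c. \<not> invertible_bop U U (\<lambda>x. T x - c *\<^sub>C x)}"

text \<open>
  On a nonzero Hilbert space the spectrum is nonempty, so the inclusion below is an equality;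
  the inclusion also covers the zero space, on which the spectrum is empty.
\<close>

definition quasinilpotent :: "'a::complex_inner set \<Rightarrow> ('a \<Rightarrow> 'a) \<Rightarrow> bool" where
  "quasinilpotent U T \<longleftrightarrow> T \<in> bop U U \<and> spectrum U T \<subseteq> {0}"

definition null_space :: "('a::complex_inner \<Rightarrow> 'b::complex_inner) \<Rightarrow> 'a set" where
  "null_space T = {x. T x = 0}"

definition adj :: "('a::complex_inner \<Rightarrow> 'b::complex_inner) \<Rightarrow> 'b \<Rightarrow> 'a" where
  "adj T = (THE S. S \<in> bop UNIV UNIV \<and> (\<forall>x y. cinner (T x) y = cinner x (S y)))"

text \<open>The block matrix has rows \<open>[T11, T12]\<close> and \<open>[T21, T22]\<close>.\<close>

definition block_matrix ::
  "'a::complex_inner set \<Rightarrow> 'a set \<Rightarrow> 'b::complex_inner set \<Rightarrow> 'b set \<Rightarrow> ('a \<Rightarrow> 'b) \<Rightarrow>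
   ('a \<Rightarrow> 'b) \<Rightarrow> ('a \<Rightarrow> 'b) \<Rightarrow> ('a \<Rightarrow> 'b) \<Rightarrow> ('a \<Rightarrow> 'b) \<Rightarrow> bool" where
  "block_matrix U1 U2 V1 V2 T T11 T12 T21 T22 \<longleftrightarrow>
     orthogonal_sum U1 U2 \<and> orthogonal_sum V1 V2 \<and>
     T11 \<in> bop U1 V1 \<and> T12 \<in> bop U2 V1 \<and> T21 \<in> bop U1 V2 \<and> T22 \<in> bop U2 V2 \<and>
     (\<forall>u1\<in>U1. \<forall>u2\<in>U2. T (u1 + u2) = (T11 u1 + T12 u2) + (T21 u1 + T22 u2))"


section \<open>Generalized inverses\<close>

definition is_gDrazin_inverse :: "('a::complex_inner \<Rightarrow> 'a) \<Rightarrow> ('a \<Rightarrow> 'a) \<Rightarrow> bool" where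
  "is_gDrazin_inverse T S \<longleftrightarrow> S \<in> bop UNIV UNIV \<and> T \<circ> S = S \<circ> T \<and> S \<circ> T \<circ> S = S \<and>
     quasinilpotent UNIV (\<lambda>x. T x - T (T (S x)))"

definition gDrazin_invertible :: "('a::complex_inner \<Rightarrow> 'a) \<Rightarrow> bool" where
  "gDrazin_invertible T \<longleftrightarrow> T \<in> bop UNIV UNIV \<and> (\<exists>S. is_gDrazin_inverse T S)"

definition gDrazin :: "('a::complex_inner \<Rightarrow> 'a) \<Rightarrow> 'a \<Rightarrow> 'a" where
  "gDrazin T = (THE S. is_gDrazin_inverse T S)"

definition is_WgDrazin_inverse ::
  "('b::complex_inner \<Rightarrow> 'a::complex_inner) \<Rightarrow> ('a \<Rightarrow> 'b) \<Rightarrow> ('a \<Rightarrow> 'b) \<Rightarrow> bool" where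
  "is_WgDrazin_inverse W A B \<longleftrightarrow> B \<in> bop UNIV UNIV \<and>
     A \<circ> W \<circ> B = B \<circ> W \<circ> A \<and> B \<circ> W \<circ> A \<circ> W \<circ> B = B \<and>
     quasinilpotent UNIV ((\<lambda>x. A x - (A \<circ> W \<circ> B \<circ> W \<circ> A) x) \<circ> W)"

definition WgDrazin_invertible ::
  "('b::complex_inner \<Rightarrow> 'a::complex_inner) \<Rightarrow> ('a \<Rightarrow> 'b) \<Rightarrow> bool" where
  "WgDrazin_invertible W A \<longleftrightarrow> A \<in> bop UNIV UNIV \<and> (\<exists>B. is_WgDrazin_inverse W A B)"

definition coreEP :: "('a::complex_inner \<Rightarrow> 'a) \<Rightarrow> 'a \<Rightarrow> 'a" where
  "coreEP T = (THE B. B \<in> bop UNIV UNIV \<and>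
     T \<circ> B = proj (range (gDrazin T)) \<and> range B \<subseteq> range (gDrazin T))"

definition weak_group :: "('a::complex_inner \<Rightarrow> 'a) \<Rightarrow> 'a \<Rightarrow> 'a" where
  "weak_group T = coreEP T \<circ> coreEP T \<circ> T"

definition WcoreEP ::
  "('b::complex_inner \<Rightarrow> 'a::complex_inner) \<Rightarrow> ('a \<Rightarrow> 'b) \<Rightarrow> 'a \<Rightarrow> 'b" where
  "WcoreEP W A = (THE B. B \<in> bop UNIV UNIV \<and>
     W \<circ> A \<circ> W \<circ> B = proj (range (gDrazin (W \<circ> A))) \<and> range B \<subseteq> range (gDrazin (A \<circ> W)))"

definition Wweak_group ::
  "('b::complex_inner \<Rightarrow> 'a::complex_inner) \<Rightarrow> ('a \<Rightarrow> 'b) \<Rightarrow> 'a \<Rightarrow> 'b" where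
  "Wweak_group W A = WcoreEP W A \<circ> W \<circ> WcoreEP W A \<circ> W \<circ> A"


section \<open>Weak group relations\<close>

definition wg_le :: "('a::complex_inner \<Rightarrow> 'a) \<Rightarrow> ('a \<Rightarrow> 'a) \<Rightarrow> bool" where
  "wg_le T S \<longleftrightarrow> gDrazin_invertible T \<and> S \<in> bop UNIV UNIV \<and>
     T \<circ> weak_group T = S \<circ> weak_group T \<and> weak_group T \<circ> T = weak_group T \<circ> S"

definition Wwg_le_l ::
  "('b::complex_inner \<Rightarrow> 'a::complex_inner) \<Rightarrow> ('a \<Rightarrow> 'b) \<Rightarrow> ('a \<Rightarrow> 'b) \<Rightarrow> bool" where
  "Wwg_le_l W A B \<longleftrightarrow> WgDrazin_invertible W A \<and> B \<in> bop UNIV UNIV \<and>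
     wg_le (W \<circ> A) (W \<circ> B)"

end

theory Submission
  imports Defs "HOL-Complex_Analysis.Cauchy_Integral_Formula"
begin

text \<open>
  Let \<open>D\<close> be the weighted generalized Drazin inverse of \<open>A\<close>. The generalized Drazin inverses of
  \<open>WA\<close> and \<open>AW\<close> are \<open>WD\<close> and \<open>DW\<close>, and with the orthogonal projector \<open>P\<close> onto \<open>R(WD)\<close> the
  core-EP inverse of \<open>WA\<close> is \<open>WDP\<close> and the weighted core-EP inverse of \<open>A\<close> is \<open>DP\<close>. Hence \<open>W\<close> times
  the weighted weak group inverse of \<open>A\<close> is the weak group inverse of \<open>WA\<close>, so (i), (ii) and (iii)
  coincide, and they amount to \<open>WAx = WBx\<close> for \<open>x \<in> R(WD)\<close> together with \<open>P(WAW(A - B)) = 0\<close>. As \<open>A\<close>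
  and \<open>W\<close> are upper triangular with invertible upper left corners, these two equations express the conditions on the
  left column and the upper right corner of \<open>B\<close>.

  Quasinilpotency is a condition on the spectrum. It enters the uniqueness of the generalized Drazin
  inverse through Liouville's theorem for the entire function \<open>z \<mapsto> (1 - zN)\<^sup>-\<^sup>1\<close>, without the spectral
  radius formula.
\<close>

section \<open>Inner products\<close>

lemma cinner_zero_left [simp]: "cinner 0 y = 0"
  using cinner_add_left [of 0 0 y] by simp

lemma cinner_minus_left: "cinner (- x) y = - cinner x y"
  using cinner_add_left [of x "- x" y] by (simp add: add_eq_0_iff)

lemma cinner_diff_left: "cinner (x - y) z = cinner x z - cinner y z"
  using cinner_add_left [of x "- y" z] by (simp add: cinner_minus_left)

lemma cinner_diff_right: "cinner x (y - z) = cinner x y - cinner x z"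
  by (metis cinner_diff_left cinner_commute complex_cnj_diff)

lemma cinner_zero_right [simp]: "cinner x 0 = 0"
  by (metis cinner_commute cinner_zero_left complex_cnj_zero)

lemma cinner_scaleC_right: "cinner x (a *\<^sub>C y) = cnj a * cinner x y"
  by (metis cinner_commute cinner_scaleC_left complex_cnj_mult)

lemma cinner_eq_zero_iff [simp]: "cinner x x = 0 \<longleftrightarrow> x = 0"
  by (simp add: cinner_self)

lemma cinner_eqI: "x = y" if "\<And>z. cinner x z = cinner y z"
proof -
  have "cinner (x - y) (x - y) = 0"
    using that by (simp add: cinner_diff_left)
  then show ?thesis by simp
qed

text \<open>The class assumes homogeneity of the norm only for real scalars; for complex ones it
  comes from the norm being induced by the inner product.\<close>

lemma norm_scaleC: "norm (c *\<^sub>C x) = cmod c * norm x"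
proof -
  have "complex_of_real ((norm (c *\<^sub>C x))\<^sup>2) = complex_of_real ((cmod c * norm x)\<^sup>2)"
    by (simp only: cinner_scaleC_left cinner_scaleC_right complex_norm_square power_mult_distrib
        of_real_mult mult.assoc mult.left_commute flip: cinner_self)
  then have "(norm (c *\<^sub>C x))\<^sup>2 = (cmod c * norm x)\<^sup>2"
    using of_real_eq_iff by blast
  then show ?thesis
    by (simp add: power2_eq_iff_nonneg)
qed

lemma norm_diff_sq: "(norm (x - y))\<^sup>2 = (norm x)\<^sup>2 - 2 * Re (cinner x y) + (norm y)\<^sup>2"
proof -
  have "Re (cinner (x - y) (x - y)) = Re (cinner x x) - (Re (cinner x y) + Re (cinner y x)) + Re (cinner y y)"
    by (simp add: cinner_diff_left cinner_diff_right)
  moreover have "Re (cinner y x) = Re (cinner x y)"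
    by (metis cinner_commute complex_cnj_cancel_iff cnj.simps(1))
  ultimately show ?thesis
    by (simp add: cinner_self)
qed

lemma norm_add_sq: "(norm (x + y))\<^sup>2 = (norm x)\<^sup>2 + 2 * Re (cinner x y) + (norm y)\<^sup>2"
proof -
  have "cinner x (- y) = - cinner x y"
    using cinner_diff_right [of x 0 y] by simp
  then show ?thesis
    using norm_diff_sq [of x "- y"] by simp
qed

lemma parallelogram:
  fixes x y :: "'a::complex_inner"
  shows "(norm (x + y))\<^sup>2 + (norm (x - y))\<^sup>2 = 2 * (norm x)\<^sup>2 + 2 * (norm y)\<^sup>2"
  by (simp add: norm_add_sq norm_diff_sq)

text \<open>Pythagoras for removing from \<open>x\<close> its component along \<open>y\<close>.
  Nonnegativity of the left side gives Cauchy-Schwarz; the strict decrease for a nonzero inner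
  product gives orthogonality at a nearest point.\<close>

lemma norm_diff_component_sq:
  assumes "y \<noteq> 0"
  shows "(norm (x - (cinner x y / (norm y)\<^sup>2) *\<^sub>C y))\<^sup>2 = (norm x)\<^sup>2 - (cmod (cinner x y))\<^sup>2 / (norm y)\<^sup>2"
proof -
  have "cinner x ((cinner x y / (norm y)\<^sup>2) *\<^sub>C y) = cnj (cinner x y) * cinner x y / (norm y)\<^sup>2"
    by (simp add: cinner_scaleC_right)
  also have "\<dots> = complex_of_real ((cmod (cinner x y))\<^sup>2 / (norm y)\<^sup>2)"
    by (simp only: complex_norm_square of_real_divide mult.commute)
  finally have "Re (cinner x ((cinner x y / (norm y)\<^sup>2) *\<^sub>C y)) = (cmod (cinner x y))\<^sup>2 / (norm y)\<^sup>2"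
    by simp
  moreover have "(norm ((cinner x y / (norm y)\<^sup>2) *\<^sub>C y))\<^sup>2 = (cmod (cinner x y))\<^sup>2 / (norm y)\<^sup>2"
    using assms by (simp add: norm_scaleC norm_divide norm_power power_divide)
      (simp add: field_simps power2_eq_square power4_eq_xxxx)
  ultimately show ?thesis
    by (simp add: norm_diff_sq)
qed

lemma cinner_Cauchy_Schwarz: "cmod (cinner x y) \<le> norm x * norm y"
proof (cases "y = 0")
  case False
  have "(cmod (cinner x y))\<^sup>2 / (norm y)\<^sup>2 \<le> (norm x)\<^sup>2"
    using norm_diff_component_sq [OF False, of x] zero_le_power2
    by (metis diff_ge_0_iff_ge)
  then have "(cmod (cinner x y))\<^sup>2 \<le> (norm x * norm y)\<^sup>2"
    using False by (simp add: divide_le_eq power_mult_distrib)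
  then show ?thesis
    by (rule power2_le_imp_le) simp
qed simp


section \<open>Bounded operators on the whole space\<close>

lemma bop_bounded_linear: "T \<in> bop UNIV UNIV \<Longrightarrow> bounded_linear T"
  by (simp add: bop_UNIV_iff)

lemma bop_scaleC: "T \<in> bop UNIV UNIV \<Longrightarrow> T (c *\<^sub>C x) = c *\<^sub>C T x"
  by (simp add: bop_UNIV_iff)

lemma bop_add: "T \<in> bop UNIV UNIV \<Longrightarrow> T (x + y) = T x + T y"
  by (simp add: bop_UNIV_iff linear_simps)

lemma bop_diff: "T \<in> bop UNIV UNIV \<Longrightarrow> T (x - y) = T x - T y"
  by (simp add: bop_UNIV_iff linear_simps)

lemma bop_minus: "T \<in> bop UNIV UNIV \<Longrightarrow> T (- x) = - T x"
  by (simp add: bop_UNIV_iff linear_simps)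

lemma bop_zero: "T \<in> bop UNIV UNIV \<Longrightarrow> T 0 = 0"
  by (simp add: bop_UNIV_iff linear_simps)

lemma bop_compose:
  "S \<in> bop UNIV UNIV \<Longrightarrow> T \<in> bop UNIV UNIV \<Longrightarrow> S \<circ> T \<in> bop UNIV UNIV"
  by (auto simp: bop_UNIV_iff o_def intro: bounded_linear_compose)

lemma bop_ident: "(\<lambda>x. x) \<in> bop UNIV UNIV"
  by (simp add: bop_UNIV_iff bounded_linear_ident)

lemma bop_sub:
  "S \<in> bop UNIV UNIV \<Longrightarrow> T \<in> bop UNIV UNIV \<Longrightarrow> (\<lambda>x. S x - T x) \<in> bop UNIV UNIV"
  by (auto simp: bop_UNIV_iff complex_vector.scale_right_diff_distrib intro: bounded_linear_sub)

lemma bop_scale: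
  assumes "T \<in> bop UNIV UNIV"
  shows "(\<lambda>x. c *\<^sub>C T x) \<in> bop UNIV UNIV"
proof -
  obtain K where "\<And>x. norm (T x) \<le> norm x * K"
    using assms by (auto simp: bop_def)
  then have "norm (c *\<^sub>C T x) \<le> norm x * (cmod c * K)" for x
    using mult_left_mono [of "norm (T x)" "norm x * K" "cmod c"]
    by (simp add: norm_scaleC mult_ac)
  then have "\<exists>K. \<forall>x. norm (c *\<^sub>C T x) \<le> norm x * K"
    by blast
  with assms show ?thesis
    by (simp add: bop_def scaleC_add_right scaleC_scaleC mult.commute)
qed

lemma bop_mono:
  "T \<in> bop UNIV UNIV \<Longrightarrow> (\<And>x. x \<in> U \<Longrightarrow> T x \<in> V) \<Longrightarrow> T \<in> bop U V"
  by (auto simp: bop_def)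

text \<open>Membership in \<open>bop U V\<close> sees only values on \<open>U\<close>. That
  \<open>U\<close> is a subspace ensures that sums and multiples of its elements are again points of
  agreement.\<close>

lemma bop_cong: "T \<in> bop U V" if "S \<in> bop U V" "csubspace U" "\<And>x. x \<in> U \<Longrightarrow> T x = S x"
proof -
  have "x + y \<in> U" "c *\<^sub>C x \<in> U" if "x \<in> U" "y \<in> U" for x y c
    using that \<open>csubspace U\<close> complex_vector.subspace_add complex_vector.subspace_scale by blast+
  with that(1,3) show ?thesis
    unfolding bop_def mem_Collect_eq by metis
qed


section \<open>Orthogonal projections and adjoints\<close>

definition orth :: "'a::complex_inner set \<Rightarrow> 'a set" where
  "orth L = {x. \<forall>z\<in>L. cinner x z = 0}"

lemma csubspace_orth: "csubspace (orth L)"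
  by (rule complex_vector.subspaceI) (simp_all add: orth_def cinner_add_left cinner_scaleC_left)

lemma csubspace_range: "T \<in> bop UNIV UNIV \<Longrightarrow> csubspace (range T)"
  by (rule complex_vector.subspaceI) (auto simp flip: bop_zero bop_add bop_scaleC)

text \<open>A minimizing sequence is Cauchy by the parallelogram law, and its limit attains the
  infimum because \<open>L\<close> is closed.\<close>

lemma nearest_point_exists:
  fixes L :: "'a::chilbert_space set"
  assumes L: "csubspace L" and "closed L"
  shows "\<exists>y\<in>L. \<forall>z\<in>L. (norm (x - y))\<^sup>2 \<le> (norm (x - z))\<^sup>2"
proof -
  let ?f = "\<lambda>y. (norm (x - y))\<^sup>2"
  define d where "d = (INF y\<in>L. ?f y)"
  have bdd: "bdd_below (?f ` L)"
    by (intro bdd_belowI [of _ 0]) auto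
  have ne: "L \<noteq> {}"
    using L complex_vector.subspace_0 by blast
  have lower: "d \<le> ?f y" if "y \<in> L" for y
    unfolding d_def by (intro cINF_lower bdd that)
  have "\<exists>y\<in>L. ?f y < d + inverse (real (Suc n))" for n
    using cINF_less_iff [OF ne bdd, of "d + inverse (real (Suc n))"]
    unfolding d_def by simp
  then obtain y where yL: "\<And>n. y n \<in> L"
    and y: "\<And>n. ?f (y n) < d + inverse (real (Suc n))"
    by metis
  \<comment> \<open>The midpoint \<open>?h\<close> lies in \<open>L\<close>, so it is no closer to
    \<open>x\<close> than the infimum allows; the parallelogram law then bounds the difference of
    two nearly optimal points.\<close>
  have est: "(norm (y m - y n))\<^sup>2 \<le> 4 * inverse (real (Suc k))" if "k \<le> m" "k \<le> n" for k m n
  proof -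
    let ?h = "(1/2) *\<^sub>R (y m + y n)"
    have "?h \<in> L"
      using L yL by (simp add: scaleR_scaleC complex_vector.subspace_add complex_vector.subspace_scale)
    then have "d \<le> ?f ?h"
      by (rule lower)
    moreover have "(x - y m) + (x - y n) = 2 *\<^sub>R (x - ?h)"
      by (simp add: algebra_simps scaleR_2)
    then have "(norm ((x - y m) + (x - y n)))\<^sup>2 = 4 * ?f ?h"
      by (simp add: power_mult_distrib)
    moreover have "norm ((x - y m) - (x - y n)) = norm (y m - y n)"
      by (simp add: norm_minus_commute)
    ultimately have "(norm (y m - y n))\<^sup>2 \<le> 2 * ?f (y m) + 2 * ?f (y n) - 4 * d"
      using parallelogram [of "x - y m" "x - y n"] by simp
    also have "\<dots> \<le> 2 * inverse (real (Suc m)) + 2 * inverse (real (Suc n))"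
      using y [of m] y [of n] by simp
    also have "\<dots> \<le> 4 * inverse (real (Suc k))"
      using le_imp_inverse_le [of "real (Suc k)" "real (Suc m)"]
        le_imp_inverse_le [of "real (Suc k)" "real (Suc n)"] that by linarith
    finally show ?thesis .
  qed
  have "Cauchy y"
  proof (rule metric_CauchyI)
    fix e :: real assume "0 < e"
    then have "0 < e\<^sup>2 / 4" by simp
    then obtain k where k: "inverse (real (Suc k)) < e\<^sup>2 / 4"
      using reals_Archimedean by blast
    have "dist (y m) (y n) < e" if "k \<le> m" "k \<le> n" for m n
    proof -
      have "(norm (y m - y n))\<^sup>2 < e\<^sup>2"
        using est [OF that] k by linarith
      then show ?thesis
        using \<open>0 < e\<close> by (simp add: dist_norm power_less_imp_less_base)
    qed
    then show "\<exists>M. \<forall>m\<ge>M. \<forall>n\<ge>M. dist (y m) (y n) < e"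
      by blast
  qed
  then obtain l where l: "y \<longlonglongrightarrow> l"
    using Cauchy_convergent convergent_def by blast
  then have "l \<in> L"
    using \<open>closed L\<close> yL closed_sequentially by blast
  moreover have "?f l \<le> d"
  proof (rule LIMSEQ_le)
    show "(\<lambda>n. ?f (y n)) \<longlonglongrightarrow> ?f l"
      by (intro tendsto_intros l)
    show "(\<lambda>n. d + inverse (real (Suc n))) \<longlonglongrightarrow> d"
      using tendsto_add [OF tendsto_const LIMSEQ_inverse_real_of_nat] by simp
    show "\<exists>N. \<forall>n\<ge>N. ?f (y n) \<le> d + inverse (real (Suc n))"
      using y less_imp_le by blast
  qed
  ultimately show ?thesis
    using lower by (meson order_trans)
qed

text \<open>If the residual at a nearest point had a nonzero inner product with some
  \<open>z\<close> in \<open>L\<close>, moving the point by the component along \<open>z\<close>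
  would bring it strictly closer to \<open>x\<close>.\<close>

lemma projection_exists:
  fixes L :: "'a::chilbert_space set"
  assumes L: "csubspace L" and "closed L"
  shows "\<exists>y\<in>L. x - y \<in> orth L"
proof -
  obtain y where y: "y \<in> L" and min: "\<And>z. z \<in> L \<Longrightarrow> (norm (x - y))\<^sup>2 \<le> (norm (x - z))\<^sup>2"
    using nearest_point_exists [OF assms] by blast
  have "cinner (x - y) z = 0" if "z \<in> L" for z
  proof (rule ccontr)
    assume nz: "cinner (x - y) z \<noteq> 0"
    then have "z \<noteq> 0" by auto
    let ?c = "cinner (x - y) z / (norm z)\<^sup>2"
    have "y + ?c *\<^sub>C z \<in> L"
      using L y that by (simp add: complex_vector.subspace_add complex_vector.subspace_scale)
    then have "(norm (x - y))\<^sup>2 \<le> (norm (x - y - ?c *\<^sub>C z))\<^sup>2"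
      using min by (metis diff_diff_eq)
    then have "(cmod (cinner (x - y) z))\<^sup>2 / (norm z)\<^sup>2 \<le> 0"
      unfolding norm_diff_component_sq [OF \<open>z \<noteq> 0\<close>] by simp
    then show False
      using nz \<open>z \<noteq> 0\<close> by (simp add: divide_le_0_iff)
  qed
  with y show ?thesis
    by (auto simp: orth_def)
qed

text \<open>Two candidates differ by a vector of \<open>L\<close> that is orthogonal to itself. This
  justifies the definite description and is the tool for computing projections.\<close>

lemma proj_eqI:
  assumes "csubspace L" "y \<in> L" "x - y \<in> orth L"
  shows "proj L x = y"
  unfolding proj_def
proof (rule the_equality)
  show "y \<in> L \<and> (\<forall>z\<in>L. cinner (x - y) z = 0)"
    using assms by (simp add: orth_def)
next
  fix y' assume y': "y' \<in> L \<and> (\<forall>z\<in>L. cinner (x - y') z = 0)"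
  then have "y' - y \<in> L"
    using assms by (simp add: complex_vector.subspace_diff)
  then have "cinner (x - y) (y' - y) - cinner (x - y') (y' - y) = 0"
    using assms y' by (simp add: orth_def)
  then have "cinner (y' - y) (y' - y) = 0"
    by (simp flip: cinner_diff_left)
  then show "y' = y" by simp
qed

locale closed_csubspace =
  fixes L :: "'a::chilbert_space set"
  assumes csubspace: "csubspace L" and closed: "closed L"
begin

lemma proj_in: "proj L x \<in> L" and diff_proj_orth: "x - proj L x \<in> orth L"
  using projection_exists [OF csubspace closed, of x] proj_eqI [OF csubspace] by auto

lemma proj_ident: "x \<in> L \<Longrightarrow> proj L x = x"
  by (rule proj_eqI [OF csubspace]) (simp_all add: orth_def)

lemma proj_orth: "x \<in> orth L \<Longrightarrow> proj L x = 0"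
  by (rule proj_eqI [OF csubspace]) (simp_all add: csubspace complex_vector.subspace_0)

lemma norm_proj_le: "norm (proj L x) \<le> norm x"
proof -
  have "cinner (x - proj L x) (proj L x) = 0"
    using proj_in diff_proj_orth by (simp add: orth_def)
  then have "(norm x)\<^sup>2 = (norm (x - proj L x))\<^sup>2 + (norm (proj L x))\<^sup>2"
    using norm_add_sq [of "x - proj L x" "proj L x"] by simp
  then have "(norm (proj L x))\<^sup>2 \<le> (norm x)\<^sup>2"
    by simp
  then show ?thesis
    by (rule power2_le_imp_le) simp
qed

lemma proj_bop: "proj L \<in> bop UNIV UNIV"
proof -
  have "proj L (x + y) = proj L x + proj L y" for x y
  proof (rule proj_eqI [OF csubspace])
    show "proj L x + proj L y \<in> L"
      by (simp add: csubspace complex_vector.subspace_add proj_in)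
    show "x + y - (proj L x + proj L y) \<in> orth L"
      using complex_vector.subspace_add [OF csubspace_orth diff_proj_orth [of x] diff_proj_orth [of y]]
      by (simp add: algebra_simps)
  qed
  moreover have "proj L (c *\<^sub>C x) = c *\<^sub>C proj L x" for c x
  proof (rule proj_eqI [OF csubspace])
    show "c *\<^sub>C proj L x \<in> L"
      by (simp add: csubspace complex_vector.subspace_scale proj_in)
    show "c *\<^sub>C x - c *\<^sub>C proj L x \<in> orth L"
      using complex_vector.subspace_scale [OF csubspace_orth diff_proj_orth [of x]]
      by (simp add: complex_vector.scale_right_diff_distrib)
  qed
  ultimately show ?thesis
    using norm_proj_le by (auto simp: bop_def intro: exI [of _ 1])
qed

lemma orthogonal_sum_orth: "orthogonal_sum L (orth L)"
proof -
  have "x = proj L x + (x - proj L x)" for x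
    by simp
  then have "\<exists>u\<in>L. \<exists>v\<in>orth L. x = u + v" for x
    using proj_in diff_proj_orth by blast
  moreover have "cinner u v = 0" if "u \<in> L" "v \<in> orth L" for u v
    using that by (simp add: orth_def) (metis cinner_commute complex_cnj_zero)
  ultimately show ?thesis
    by (simp add: orthogonal_sum_def csubspace csubspace_orth)
qed

end

text \<open>For \<open>u\<close> orthogonal to the kernel with \<open>f u\<close> nonzero, the
  vector \<open>f u *\<^sub>C x - f x *\<^sub>C u\<close> lies in the kernel; orthogonality to
  \<open>u\<close> then expresses \<open>f x\<close> through the inner product of \<open>x\<close>
  with \<open>u\<close>.\<close>

lemma Riesz_representation:
  fixes f :: "'a::chilbert_space \<Rightarrow> complex"
  assumes f: "bounded_linear f" and hom: "\<And>c x. f (c *\<^sub>C x) = c * f x"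
  shows "\<exists>y. \<forall>x. f x = cinner x y"
proof (cases "\<forall>x. f x = 0")
  case True
  then show ?thesis by (intro exI [of _ 0]) simp
next
  case False
  then obtain v where v: "f v \<noteq> 0" by blast
  interpret bounded_linear f by fact
  let ?L = "{x. f x = 0}"
  interpret L: closed_csubspace ?L
  proof
    show "csubspace ?L"
      using zero by (auto simp: complex_vector.subspace_def add hom)
    show "closed ?L"
      by (intro closed_Collect_eq continuous_on_const linear_continuous_on f)
  qed
  define u where "u = v - proj ?L v"
  have u: "u \<in> orth ?L"
    unfolding u_def by (rule L.diff_proj_orth)
  have fu: "f u \<noteq> 0"
    using v L.proj_in [of v] by (simp add: u_def diff)
  then have "u \<noteq> 0"
    using zero by auto
  have "f x = cinner x ((cnj (f u) / (norm u)\<^sup>2) *\<^sub>C u)" for x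
  proof -
    have "f (f u *\<^sub>C x - f x *\<^sub>C u) = 0"
      by (simp add: diff hom)
    then have "cinner u (f u *\<^sub>C x - f x *\<^sub>C u) = 0"
      using u by (simp add: orth_def)
    then have "cinner (f u *\<^sub>C x - f x *\<^sub>C u) u = 0"
      by (metis cinner_commute complex_cnj_zero)
    then have "f u * cinner x u = f x * (norm u)\<^sup>2"
      by (simp add: cinner_diff_left cinner_scaleC_left cinner_self)
    then show ?thesis
      using \<open>u \<noteq> 0\<close> by (simp add: cinner_scaleC_right field_simps)
  qed
  then show ?thesis by blast
qed

lemma bounded_linear_cinner_compose:
  assumes "T \<in> bop UNIV UNIV"
  shows "bounded_linear (\<lambda>x. cinner (T x) y)"
proof -
  obtain K where K: "\<And>x. norm (T x) \<le> norm x * K"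
    using assms by (auto simp: bop_def)
  show ?thesis
  proof (rule bounded_linear_intro)
    fix x
    show "cmod (cinner (T x) y) \<le> norm x * (K * norm y)"
      using cinner_Cauchy_Schwarz [of "T x" y] mult_right_mono [OF K [of x], of "norm y"]
      by (simp add: mult.assoc)
  qed (use assms in \<open>simp_all add: bop_add bop_scaleC cinner_add_left scaleR_scaleC cinner_scaleC_left scaleR_conv_of_real\<close>)
qed

text \<open>Riesz yields \<open>S y\<close> pointwise. Linearity follows by testing against all
  vectors, and boundedness from writing the squared norm of \<open>S y\<close> as the inner product
  of \<open>T (S y)\<close> with \<open>y\<close>.\<close>

lemma adjoint_exists:
  fixes T :: "'a::chilbert_space \<Rightarrow> 'b::complex_inner"
  assumes T: "T \<in> bop UNIV UNIV"
  shows "\<exists>S \<in> bop UNIV UNIV. \<forall>x y. cinner (T x) y = cinner x (S y)"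
proof -
  have "\<exists>s. \<forall>x. cinner (T x) y = cinner x s" for y
    by (rule Riesz_representation)
      (simp_all add: bounded_linear_cinner_compose T bop_scaleC cinner_scaleC_left)
  then obtain S where S: "\<And>x y. cinner (T x) y = cinner x (S y)"
    by metis
  have S': "cinner (S y) x = cinner y (T x)" for x y
    by (metis S cinner_commute)
  obtain K where "0 < K" and K: "\<And>x. norm (T x) \<le> norm x * K"
    using bounded_linear.pos_bounded [OF bop_bounded_linear [OF T]] by blast
  have "norm (S y) \<le> norm y * K" for y
  proof (cases "S y = 0")
    case True
    with \<open>0 < K\<close> show ?thesis by simp
  next
    case False
    have "(norm (S y))\<^sup>2 = Re (cinner (T (S y)) y)"
      by (simp add: S cinner_self)
    also have "\<dots> \<le> norm (T (S y)) * norm y"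
      using complex_Re_le_cmod cinner_Cauchy_Schwarz order_trans by blast
    also have "\<dots> \<le> norm (S y) * K * norm y"
      using K by (simp add: mult_right_mono)
    finally show ?thesis
      using False by (simp add: power2_eq_square mult_ac)
  qed
  moreover have "S (x + y) = S x + S y" for x y
    by (rule cinner_eqI) (simp add: S' cinner_add_left)
  moreover have "S (c *\<^sub>C x) = c *\<^sub>C S x" for c x
    by (rule cinner_eqI) (simp add: S' cinner_scaleC_left)
  ultimately have "S \<in> bop UNIV UNIV"
    by (auto simp: bop_def)
  with S show ?thesis by blast
qed

text \<open>Turns the second summands of the orthogonal sums into plain orthogonal complements of
  ranges. Existence and uniqueness of the adjoint give access to the definite description.\<close>

lemma null_space_adj:
  fixes T :: "'a::chilbert_space \<Rightarrow> 'b::complex_inner"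
  assumes T: "T \<in> bop UNIV UNIV"
  shows "null_space (adj T) = orth (range T)"
proof -
  let ?P = "\<lambda>S. S \<in> bop UNIV UNIV \<and> (\<forall>x y. cinner (T x) y = cinner x (S y))"
  obtain S where S: "?P S"
    using adjoint_exists [OF T] by blast
  have uniq: "S' = S" if "?P S'" for S'
  proof
    fix y show "S' y = S y"
    proof (rule cinner_eqI)
      fix z show "cinner (S' y) z = cinner (S y) z"
        using S that by (metis cinner_commute)
    qed
  qed
  have "adj T = S"
    unfolding adj_def by (rule the_equality [of ?P, OF S uniq])
  moreover have "S y = 0 \<longleftrightarrow> (\<forall>x. cinner y (T x) = 0)" for y
    using S by (metis cinner_commute cinner_eq_zero_iff cinner_zero_right complex_cnj_zero)
  ultimately show ?thesis
    by (auto simp: null_space_def orth_def)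
qed


section \<open>Quasinilpotent operators\<close>

lemma invertible_bop_UNIV_iff:
  "invertible_bop UNIV UNIV T \<longleftrightarrow>
    T \<in> bop UNIV UNIV \<and> (\<exists>S\<in>bop UNIV UNIV. (\<forall>x. T (S x) = x) \<and> (\<forall>x. S (T x) = x))"
    (is "?lhs \<longleftrightarrow> ?rhs")
proof
  assume ?lhs
  then show ?rhs
    unfolding invertible_bop_def by (metis bij_is_inj bij_is_surj inv_f_f surj_f_inv_f)
next
  assume ?rhs
  then obtain S where S: "T \<in> bop UNIV UNIV" "S \<in> bop UNIV UNIV" "\<And>x. T (S x) = x" "\<And>x. S (T x) = x"
    by blast
  then have "bij T"
    by (metis bijI')
  moreover have "inv T = S"
    using S by (intro inv_equality) auto
  ultimately show ?lhs
    using S by (simp add: invertible_bop_def)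
qed

text \<open>Replaces the spectral condition by explicit two-sided bounded inverses of
  \<open>T - c\<close>, the form in which resolvents are constructed and used below.\<close>

lemma quasinilpotent_UNIV_iff:
  "quasinilpotent UNIV T \<longleftrightarrow> T \<in> bop UNIV UNIV \<and>
    (\<forall>c. c \<noteq> 0 \<longrightarrow> (\<exists>S\<in>bop UNIV UNIV. (\<forall>x. T (S x) - c *\<^sub>C S x = x) \<and> (\<forall>x. S (T x - c *\<^sub>C x) = x)))"
proof (cases "T \<in> bop UNIV UNIV")
  case True
  then have "(\<lambda>x. T x - c *\<^sub>C x) \<in> bop UNIV UNIV" for c
    by (rule bop_sub [OF _ bop_scale [OF bop_ident]])
  with True show ?thesis
    unfolding quasinilpotent_def spectrum_def invertible_bop_UNIV_iff by blast
qed (simp add: quasinilpotent_def)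

text \<open>The weighted definition demands quasinilpotency on \<open>Y\<close> only; this
  transports it to the product in the other order, which acts on \<open>X\<close>.\<close>

lemma quasinilpotent_swap:
  assumes Q: "Q \<in> bop UNIV UNIV" and W: "W \<in> bop UNIV UNIV"
    and "quasinilpotent UNIV (Q \<circ> W)"
  shows "quasinilpotent UNIV (W \<circ> Q)"
  unfolding quasinilpotent_UNIV_iff
proof (intro conjI allI impI bop_compose W Q)
  fix c :: complex assume "c \<noteq> 0"
  then obtain R where R: "R \<in> bop UNIV UNIV" "\<And>x. Q (W (R x)) - c *\<^sub>C R x = x"
    "\<And>x. R (Q (W x) - c *\<^sub>C x) = x"
    using assms(3) by (auto simp: quasinilpotent_UNIV_iff)
  \<comment> \<open>Jacobson's formula for the resolvent of a product in the reversed order\<close>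
  let ?S = "\<lambda>x. inverse c *\<^sub>C (W (R (Q x)) - x)"
  have S: "?S \<in> bop UNIV UNIV"
    using bop_scale [OF bop_sub [OF bop_compose [OF W bop_compose [OF R(1) Q]] bop_ident]]
    by (simp add: o_def)
  have R2: "Q (W (R x)) = x + c *\<^sub>C R x" for x
    using R(2) [of x] by (simp add: algebra_simps)
  have R3: "R (Q (W x)) = x + c *\<^sub>C R x" for x
    using R(3) [of x] R(1) by (simp add: bop_diff bop_scaleC algebra_simps)
  have "(W \<circ> Q) (?S x) - c *\<^sub>C ?S x = x" for x
    using \<open>c \<noteq> 0\<close> W Q
    by (simp add: bop_diff bop_add bop_scaleC R2 complex_vector.scale_right_diff_distrib
        scaleC_add_right scaleC_scaleC scaleC_one)
  moreover have "?S ((W \<circ> Q) x - c *\<^sub>C x) = x" for x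
    using \<open>c \<noteq> 0\<close> W Q R(1)
    by (simp add: bop_diff bop_add bop_scaleC R3 complex_vector.scale_right_diff_distrib
        scaleC_add_right scaleC_scaleC scaleC_one)
  ultimately show "\<exists>S\<in>bop UNIV UNIV. (\<forall>x. (W \<circ> Q) (S x) - c *\<^sub>C S x = x) \<and>
      (\<forall>x. S ((W \<circ> Q) x - c *\<^sub>C x) = x)"
    using S by (intro bexI [of _ ?S]) auto
qed

section \<open>The resolvent of a quasinilpotent operator as an entire function\<close>

lemma bop_onorm: "T \<in> bop UNIV UNIV \<Longrightarrow> norm (T x) \<le> onorm T * norm x"
  by (intro onorm bop_bounded_linear)

lemma bop_onorm_nonneg: "T \<in> bop UNIV UNIV \<Longrightarrow> 0 \<le> onorm T"
  by (intro onorm_pos_le bop_bounded_linear)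

text \<open>\<open>R z\<close> is the inverse of \<open>1 - z N\<close>. This form of the resolvent
  is defined on the whole plane and is the identity at \<open>z = 0\<close>.\<close>

locale quasinilpotent_resolvent =
  fixes N :: "'a::complex_inner \<Rightarrow> 'a" and R :: "complex \<Rightarrow> 'a \<Rightarrow> 'a"
  assumes N: "N \<in> bop UNIV UNIV" and R: "R z \<in> bop UNIV UNIV"
    and right_inverse: "R z x - z *\<^sub>C N (R z x) = x"
    and left_inverse: "R z (x - z *\<^sub>C N x) = x"
begin

lemma at_zero: "R 0 x = x"
  using right_inverse [of 0 x] by simp

text \<open>Apply \<open>R z\<close> to
  \<open>(1 - z N) (R w x) = x - (z - w) N (R w x)\<close>.\<close>

lemma resolvent_identity: "R z x - R w x = (z - w) *\<^sub>C R z (N (R w x))"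
proof -
  have "R w x - z *\<^sub>C N (R w x) = x - (z - w) *\<^sub>C N (R w x)"
    using right_inverse [of w x] by (simp add: complex_vector.scale_left_diff_distrib algebra_simps)
  then have "R w x = R z (x - (z - w) *\<^sub>C N (R w x))"
    by (metis left_inverse)
  also have "\<dots> = R z x - (z - w) *\<^sub>C R z (N (R w x))"
    by (simp add: bop_diff [OF R] bop_scaleC [OF R])
  finally show ?thesis
    by (simp add: eq_diff_eq diff_eq_eq add.commute)
qed

text \<open>Near \<open>w\<close> the resolvent identity bounds \<open>R z - R w\<close> by half the
  operator norm of \<open>R z\<close>. That norm is finite, so it can be absorbed, leaving at most
  twice the norm of \<open>R w\<close>.\<close>

lemma locally_bounded: "\<exists>M. \<forall>\<^sub>F z in at w. norm (R z x) \<le> M"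
proof -
  define k where "k = onorm (\<lambda>x. N (R w x))"
  define r where "r = onorm (R w)"
  have NR: "(\<lambda>x. N (R w x)) \<in> bop UNIV UNIV"
    using bop_compose [OF N R] by (simp add: o_def)
  have k: "0 \<le> k"
    unfolding k_def using NR by (rule bop_onorm_nonneg)
  \<comment> \<open>The radius makes the perturbation factor at most one half; \<open>k + 1\<close>
    in place of \<open>k\<close> covers \<open>k = 0\<close>.\<close>
  have "norm (R z x) \<le> 2 * r * norm x" if z: "cmod (z - w) < inverse (2 * (k + 1))" for z
  proof -
    define \<rho> where "\<rho> = onorm (R z)"
    have \<rho>: "0 \<le> \<rho>"
      unfolding \<rho>_def by (intro bop_onorm_nonneg R)
    have bound: "norm (R z y) \<le> (r + \<rho> / 2) * norm y" for y
    proof -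
      have "norm (R z (N (R w y))) \<le> \<rho> * (k * norm y)"
        using bop_onorm [OF R, of z "N (R w y)"] mult_left_mono [OF bop_onorm [OF NR, of y] \<rho>]
        unfolding \<rho>_def k_def by linarith
      then have "norm (R z y - R w y) \<le> cmod (z - w) * (\<rho> * (k * norm y))"
        by (simp add: resolvent_identity norm_scaleC mult_left_mono)
      also have "\<dots> \<le> inverse (2 * (k + 1)) * (\<rho> * (k * norm y))"
        using z \<rho> k by (intro mult_right_mono) auto
      also have "\<dots> = (k / (k + 1)) * (\<rho> * norm y / 2)"
        using k by (simp add: field_simps)
      also have "\<dots> \<le> 1 * (\<rho> * norm y / 2)"
        using k \<rho> by (intro mult_right_mono) auto
      finally have "norm (R z y - R w y) \<le> \<rho> / 2 * norm y"
        by simp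
      moreover have "norm (R w y) \<le> r * norm y"
        unfolding r_def by (intro bop_onorm R)
      moreover have "norm (R z y) \<le> norm (R w y) + norm (R z y - R w y)"
        by (metis add.commute diff_add_cancel norm_triangle_ineq)
      ultimately show ?thesis
        by (simp add: distrib_right)
    qed
    \<comment> \<open>\<open>\<rho>\<close> is the least bound for \<open>R z\<close>, so the bound
      just found dominates it.\<close>
    then have "\<rho> \<le> r + \<rho> / 2"
      using \<rho> bop_onorm_nonneg [OF R, of w] unfolding \<rho>_def r_def by (intro onorm_bound) simp_all
    then have "r + \<rho> / 2 \<le> 2 * r" by simp
    then show ?thesis
      using bound [of x] by (meson mult_right_mono norm_ge_zero order_trans)
  qed
  moreover have "\<forall>\<^sub>F z in at w. cmod (z - w) < inverse (2 * (k + 1))"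
    using k by (auto simp: eventually_at dist_norm intro!: exI [of _ "inverse (2 * (k + 1))"])
  ultimately show ?thesis
    by (meson eventually_mono)
qed

lemma resolvent_tendsto: "((\<lambda>z. R z x) \<longlongrightarrow> R w x) (at w)"
proof -
  obtain M where M: "\<forall>\<^sub>F z in at w. norm (R z (N (R w x))) \<le> M"
    using locally_bounded by blast
  have "((\<lambda>z. R z x - R w x) \<longlongrightarrow> 0) (at w)"
  proof (rule Lim_null_comparison)
    show "\<forall>\<^sub>F z in at w. norm (R z x - R w x) \<le> cmod (z - w) * M"
      using M by eventually_elim (simp add: resolvent_identity norm_scaleC mult_left_mono)
    have "((\<lambda>z. cmod (z - w) * M) \<longlongrightarrow> cmod (w - w) * M) (at w)"
      by (intro tendsto_intros)
    then show "((\<lambda>z. cmod (z - w) * M) \<longlongrightarrow> 0) (at w)"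
      by simp
  qed
  then show ?thesis
    by (rule LIM_zero_cancel)
qed

text \<open>By the resolvent identity the difference quotient at \<open>w\<close> equals
  \<open>f (R z (N (R w x)))\<close>, which converges by strong continuity. Composing with a
  functional gives the scalar functions to which Liouville's theorem applies.\<close>

lemma weakly_entire:
  assumes f: "bounded_linear f" and hom: "\<And>c x. f (c *\<^sub>C x) = c * f x"
  shows "(\<lambda>z. f (R z x)) holomorphic_on UNIV"
proof -
  have "((\<lambda>z. f (R z x)) has_field_derivative f (R w (N (R w x)))) (at w)" for w
  proof -
    have "((\<lambda>z. f (R z (N (R w x)))) \<longlongrightarrow> f (R w (N (R w x)))) (at w)"
      by (intro bounded_linear.tendsto [OF f] resolvent_tendsto)
    moreover have "\<forall>\<^sub>F z in at w. f (R z (N (R w x))) = (f (R z x) - f (R w x)) / (z - w)"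
      using eventually_neq_at_within [of w w UNIV]
    proof eventually_elim
      case (elim z)
      have "f (R z x) - f (R w x) = (z - w) * f (R z (N (R w x)))"
        by (simp only: linear_diff [OF bounded_linear.linear [OF f], symmetric] resolvent_identity hom)
      with elim show ?case by simp
    qed
    ultimately show ?thesis
      unfolding has_field_derivative_iff by (simp add: tendsto_cong)
  qed
  then show ?thesis
    by (auto simp: holomorphic_on_def field_differentiable_def)
qed

end

text \<open>For nonzero \<open>z\<close>, \<open>1 - z N\<close> is \<open>- z\<close> times
  \<open>N - 1/z\<close>, so its inverse is \<open>- 1/z\<close> times the given inverse of
  \<open>N - 1/z\<close>.\<close>

lemma quasinilpotent_resolvent_exists:
  assumes "quasinilpotent UNIV N"
  shows "\<exists>R. quasinilpotent_resolvent N R"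
proof -
  have N: "N \<in> bop UNIV UNIV"
    using assms by (simp add: quasinilpotent_def)
  have "\<exists>S\<in>bop UNIV UNIV. (\<forall>x. S x - z *\<^sub>C N (S x) = x) \<and> (\<forall>x. S (x - z *\<^sub>C N x) = x)" for z
  proof (cases "z = 0")
    case True
    then show ?thesis by (intro bexI [of _ "\<lambda>x. x"]) (simp_all add: bop_ident)
  next
    case False
    then obtain S where S: "S \<in> bop UNIV UNIV" "\<And>x. N (S x) - inverse z *\<^sub>C S x = x"
      "\<And>x. S (N x - inverse z *\<^sub>C x) = x"
      using assms unfolding quasinilpotent_UNIV_iff
      by (metis nonzero_imp_inverse_nonzero)
    have S2: "N (S x) = x + inverse z *\<^sub>C S x" for x
      using S(2) [of x] by (simp add: algebra_simps)
    have S3: "S (N x) = x + inverse z *\<^sub>C S x" for x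
      using S(3) [of x] S(1) by (simp add: bop_diff bop_scaleC algebra_simps)
    show ?thesis
      using False S(1) N bop_scale [OF S(1), of "- inverse z"]
      by (intro bexI [of _ "\<lambda>x. (- inverse z) *\<^sub>C S x"])
        (simp_all add: bop_scaleC bop_minus bop_diff S2 S3 complex_vector.scale_right_diff_distrib
          scaleC_add_right scaleC_scaleC scaleC_one)
  qed
  then show ?thesis
    unfolding quasinilpotent_resolvent_def using N by metis
qed

section \<open>Liouville's theorem and intertwining relations\<close>

lemma vanishing_of_growth:
  fixes F :: "complex \<Rightarrow> 'a::complex_inner \<Rightarrow> 'b::complex_inner"
  assumes F: "\<And>z. F z \<in> bop UNIV UNIV"
    and entire: "\<And>x y. (\<lambda>z. cinner (F z x) y) holomorphic_on UNIV"
    and "0 \<le> s" "0 \<le> m"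
    and growth: "\<And>z x. norm (z *\<^sub>C F z x) \<le> (s * onorm (F z) + m) * norm x"
  shows "F z x = 0"
  \<comment> \<open>For \<open>cmod z > s\<close> the growth bound gives \<open>onorm (F z) \<le> m / (cmod z - s)\<close>, so Liouville's theorem applies.\<close>
proof (rule cinner_eqI)
  fix y
  have onorm_bound: "cmod z * onorm (F z) \<le> s * onorm (F z) + m" for z
  proof (cases "z = 0")
    case True
    with assms show ?thesis
      by (simp add: bop_onorm_nonneg)
  next
    case False
    then have "norm (F z x) \<le> (s * onorm (F z) + m) / cmod z * norm x" for x
      using growth [of z x] by (simp add: norm_scaleC pos_le_divide_eq mult_ac)
    then have "onorm (F z) \<le> (s * onorm (F z) + m) / cmod z"
      using assms by (intro onorm_bound) (simp_all add: bop_onorm_nonneg)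
    with False show ?thesis
      by (simp add: pos_le_divide_eq mult.commute)
  qed
  have "((\<lambda>z. cinner (F z x) y) \<longlongrightarrow> 0) at_infinity"
  proof (rule Lim_null_comparison)
    \<comment> \<open>The margin 1 keeps the denominator \<open>cmod z - s\<close> positive.\<close>
    have "cmod (cinner (F z x) y) \<le> m * norm x * norm y / (cmod z - s)" if "s + 1 \<le> cmod z" for z
    proof -
      have "onorm (F z) \<le> m / (cmod z - s)"
        using onorm_bound [of z] that by (simp add: pos_le_divide_eq algebra_simps)
      then have "norm (F z x) \<le> m / (cmod z - s) * norm x"
        by (meson F bop_onorm mult_right_mono norm_ge_zero order_trans)
      then have "norm (F z x) * norm y \<le> m / (cmod z - s) * norm x * norm y"
        by (rule mult_right_mono) simp
      then show ?thesis
        using cinner_Cauchy_Schwarz [of "F z x" y] by simp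
    qed
    then show "\<forall>\<^sub>F z in at_infinity. cmod (cinner (F z x) y) \<le> m * norm x * norm y / (cmod z - s)"
      unfolding eventually_at_infinity by blast
    have "filterlim (\<lambda>z. cmod z - s) at_top at_infinity"
      using filterlim_tendsto_add_at_top [OF tendsto_const filterlim_norm_at_top, of "- s"]
      by (simp add: algebra_simps)
    then show "((\<lambda>z. m * norm x * norm y / (cmod z - s)) \<longlongrightarrow> 0) at_infinity"
      by (intro tendsto_divide_0 [OF tendsto_const] filterlim_at_top_imp_at_infinity)
  qed
  then show "cinner (F z x) y = cinner 0 y"
    using Liouville_weak [OF entire] by simp
qed

text \<open>Heuristically \<open>C\<close> equals the product of the n-th power of \<open>N\<close>,
  \<open>C\<close> and the n-th power of \<open>S\<close>, which should decay. Rigorously,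
  \<open>F z = R z C\<close> satisfies \<open>z F z = F z S - C S\<close>, hence the growth bound,
  so \<open>F\<close> vanishes; at \<open>z = 0\<close> it is \<open>C\<close>.\<close>

lemma quasinilpotent_intertwine_left:
  fixes C :: "'b::complex_inner \<Rightarrow> 'a::complex_inner"
  assumes "quasinilpotent UNIV N" and C: "C \<in> bop UNIV UNIV" and S: "S \<in> bop UNIV UNIV"
    and eq: "\<And>x. N (C (S x)) = C x"
  shows "C x = 0"
proof -
  obtain R where "quasinilpotent_resolvent N R"
    using quasinilpotent_resolvent_exists [OF assms(1)] by blast
  then interpret quasinilpotent_resolvent N R .
  have RC: "(\<lambda>x. R z (C x)) \<in> bop UNIV UNIV" for z
    using bop_compose [OF R C] by (simp add: o_def)
  have CS: "(\<lambda>x. C (S x)) \<in> bop UNIV UNIV"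
    using bop_compose [OF C S] by (simp add: o_def)
  have "R 0 (C x) = 0"
  proof (rule vanishing_of_growth [OF RC])
    show "(\<lambda>z. cinner (R z (C x)) y) holomorphic_on UNIV" for x y
      using weakly_entire [OF bounded_linear_cinner_compose [OF bop_ident]]
      by (simp add: cinner_scaleC_left)
  next
    fix z x
    have "R z (C (S x) - z *\<^sub>C N (C (S x))) = C (S x)"
      by (rule left_inverse)
    then have "z *\<^sub>C R z (C x) = R z (C (S x)) - C (S x)"
      using R [of z] by (simp add: eq bop_diff bop_scaleC algebra_simps)
    then have "norm (z *\<^sub>C R z (C x)) \<le> norm (R z (C (S x))) + norm (C (S x))"
      by (simp add: norm_triangle_ineq4)
    also have "norm (R z (C (S x))) \<le> onorm (\<lambda>x. R z (C x)) * (onorm S * norm x)"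
      using bop_onorm [OF RC, of z "S x"] mult_left_mono [OF bop_onorm [OF S, of x] bop_onorm_nonneg [OF RC]]
      by (rule order_trans)
    also have "norm (C (S x)) \<le> onorm (\<lambda>x. C (S x)) * norm x"
      by (rule bop_onorm [OF CS])
    finally show "norm (z *\<^sub>C R z (C x)) \<le> (onorm S * onorm (\<lambda>x. R z (C x)) + onorm (\<lambda>x. C (S x))) * norm x"
      by (simp add: algebra_simps)
  qed (simp_all add: bop_onorm_nonneg S CS)
  then show ?thesis
    by (simp add: at_zero)
qed

text \<open>The mirror image, with \<open>F z = C (R z)\<close> and
  \<open>z F z = S F z - S C\<close>.\<close>

lemma quasinilpotent_intertwine_right:
  fixes C :: "'a::complex_inner \<Rightarrow> 'b::complex_inner"
  assumes "quasinilpotent UNIV N" and C: "C \<in> bop UNIV UNIV" and S: "S \<in> bop UNIV UNIV"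
    and eq: "\<And>x. S (C (N x)) = C x"
  shows "C x = 0"
proof -
  obtain R where "quasinilpotent_resolvent N R"
    using quasinilpotent_resolvent_exists [OF assms(1)] by blast
  then interpret quasinilpotent_resolvent N R .
  have CR: "(\<lambda>x. C (R z x)) \<in> bop UNIV UNIV" for z
    using bop_compose [OF C R] by (simp add: o_def)
  have SC: "(\<lambda>x. S (C x)) \<in> bop UNIV UNIV"
    using bop_compose [OF S C] by (simp add: o_def)
  have "C (R 0 x) = 0"
  proof (rule vanishing_of_growth [OF CR])
    show "(\<lambda>z. cinner (C (R z x)) y) holomorphic_on UNIV" for x y
      using C by (intro weakly_entire bounded_linear_cinner_compose)
        (simp_all add: bop_scaleC cinner_scaleC_left)
  next
    fix z x
    have "S (C (R z x - z *\<^sub>C N (R z x))) = S (C x)"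
      by (simp add: right_inverse)
    then have "z *\<^sub>C C (R z x) = S (C (R z x)) - S (C x)"
      using S C by (simp add: eq bop_diff bop_scaleC algebra_simps)
    then have "norm (z *\<^sub>C C (R z x)) \<le> norm (S (C (R z x))) + norm (S (C x))"
      by (simp add: norm_triangle_ineq4)
    also have "norm (S (C (R z x))) \<le> onorm S * (onorm (\<lambda>x. C (R z x)) * norm x)"
      using bop_onorm [OF S, of "C (R z x)"] mult_left_mono [OF bop_onorm [OF CR, of z x] bop_onorm_nonneg [OF S]]
      by (rule order_trans)
    also have "norm (S (C x)) \<le> onorm (\<lambda>x. S (C x)) * norm x"
      by (rule bop_onorm [OF SC])
    finally show "norm (z *\<^sub>C C (R z x)) \<le> (onorm S * onorm (\<lambda>x. C (R z x)) + onorm (\<lambda>x. S (C x))) * norm x"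
      by (simp add: algebra_simps)
  qed (simp_all add: bop_onorm_nonneg S SC)
  then show ?thesis
    by (simp add: at_zero)
qed


section \<open>Generalized Drazin, core-EP and weak group inverses\<close>

text \<open>The equations are oriented so that rewriting moves \<open>T\<close> outwards past
  \<open>S\<close>.\<close>

lemma is_gDrazin_inverseD:
  assumes "is_gDrazin_inverse T S"
  shows "S \<in> bop UNIV UNIV" "S (T x) = T (S x)" "T (S (S x)) = S x"
    "quasinilpotent UNIV (\<lambda>x. T x - T (T (S x)))"
proof -
  show "S \<in> bop UNIV UNIV" and "quasinilpotent UNIV (\<lambda>x. T x - T (T (S x)))"
    using assms unfolding is_gDrazin_inverse_def by blast+
  show commute: "S (T x) = T (S x)" for x
    using assms unfolding is_gDrazin_inverse_def fun_eq_iff by auto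
  have "S (T (S x)) = S x"
    using assms unfolding is_gDrazin_inverse_def fun_eq_iff by auto
  then show "T (S (S x)) = S x"
    by (simp only: commute)
qed

lemma gDrazin_inverse_unique:
  assumes T: "T \<in> bop UNIV UNIV"
    and S: "is_gDrazin_inverse T S" and S': "is_gDrazin_inverse T S'"
  shows "S' = S"
proof
  fix x
  note S = is_gDrazin_inverseD [OF S] and S' = is_gDrazin_inverseD [OF S']
  have TS: "(\<lambda>x. T (S x)) \<in> bop UNIV UNIV"
    using bop_compose [OF T S(1)] by (simp add: o_def)
  have TS': "(\<lambda>x. T (S' x)) \<in> bop UNIV UNIV"
    using bop_compose [OF T S'(1)] by (simp add: o_def)
  \<comment> \<open>With \<open>P = TS\<close> and \<open>Q = TS'\<close> the operators \<open>P(1 - Q)\<close> and \<open>(1 - P)Q\<close> intertwine a quasinilpotent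
    operator with a bounded one, so both vanish and \<open>P = PQ = Q\<close>.\<close>
  have "(\<lambda>x. T (S (x - T (S' x)))) \<in> bop UNIV UNIV"
    using bop_compose [OF TS bop_sub [OF bop_ident TS']] by (simp add: o_def)
  \<comment> \<open>With \<open>N = T (1 - Q)\<close> and \<open>C = P (1 - Q)\<close>,
    \<open>S C N = C\<close> holds because \<open>S T = P\<close> and \<open>Q\<close> is an
    idempotent commuting with \<open>T\<close>.\<close>
  then have "T (S (x - T (S' x))) = 0" for x
    by (rule quasinilpotent_intertwine_right [OF S'(4) _ S(1)])
      (simp add: bop_diff T S(1) S'(1) bop_zero [OF T] bop_zero [OF S(1)] S(2,3) S'(2,3))
  then have 1: "T (S (T (S' x))) = T (S x)" for x
    by (simp add: bop_diff T S(1))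
  have "(\<lambda>x. T (S' x) - T (S (T (S' x)))) \<in> bop UNIV UNIV"
    using bop_sub [OF TS' bop_compose [OF TS TS']] by (simp add: o_def)
  \<comment> \<open>Now \<open>N = T (1 - P)\<close> and \<open>C = (1 - P) Q\<close> satisfy
    \<open>N C S' = C\<close>.\<close>
  then have "T (S' x) - T (S (T (S' x))) = 0" for x
    by (rule quasinilpotent_intertwine_left [OF S(4) _ S'(1)])
      (simp add: bop_diff T S(1) S'(1) bop_zero [OF T] bop_zero [OF S(1)] S(2,3) S'(2,3))
  with 1 have eq: "T (S' x) = T (S x)" for x
    by simp
  have "S' x = T (S' (S' x))"
    by (simp add: S'(3))
  also have "\<dots> = T (S (S' x))"
    by (rule eq)
  also have "\<dots> = S (T (S' x))"
    by (simp add: S(2))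
  also have "\<dots> = S x"
    by (simp add: eq S(2,3))
  finally show "S' x = S x" .
qed

locale gDrazin_pair =
  fixes T S :: "'a::chilbert_space \<Rightarrow> 'a"
  assumes T: "T \<in> bop UNIV UNIV" and gDrazin_inverse: "is_gDrazin_inverse T S"
begin

lemma S: "S \<in> bop UNIV UNIV"
  and commute: "S (T x) = T (S x)"
  and outer: "T (S (S x)) = S x"
  and quasinilpotent: "quasinilpotent UNIV (\<lambda>x. T x - T (T (S x)))"
  using is_gDrazin_inverseD [OF gDrazin_inverse] by auto

lemma gDrazin_eq: "gDrazin T = S"
  unfolding gDrazin_def
  by (rule the_equality [of "is_gDrazin_inverse T", OF gDrazin_inverse])
    (rule gDrazin_inverse_unique [OF T gDrazin_inverse])

text \<open>\<open>T \<circ> S\<close> is an idempotent with the same range as \<open>S\<close>. As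
  the fixed-point set of a continuous map this range is closed, so the orthogonal projector onto it
  is available.\<close>

lemma range_iff: "x \<in> range S \<longleftrightarrow> T (S x) = x"
  by (metis commute outer rangeE rangeI)

sublocale closed_csubspace "range S"
proof
  show "csubspace (range S)"
    by (rule csubspace_range [OF S])
  have "range S = {x. T (S x) = x}"
    using range_iff by blast
  moreover have "continuous_on UNIV (\<lambda>x. T (S x))"
    using bop_bounded_linear [OF bop_compose [OF T S]]
    by (simp add: o_def linear_continuous_on)
  ultimately show "closed (range S)"
    by (simp add: closed_Collect_eq continuous_on_id)
qed

lemma gDrazin_invertible: "gDrazin_invertible T"
  using T gDrazin_inverse by (auto simp: gDrazin_invertible_def)

text \<open>\<open>S T\<close> is the identity on the range of \<open>S\<close>. Hence an operator
  \<open>B\<close> with values there and \<open>T B = P\<close> must be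
  \<open>S T B = S P\<close>.\<close>

lemma coreEP_eq: "coreEP T = S \<circ> proj (range S)"
  unfolding coreEP_def gDrazin_eq
proof (rule the_equality)
  have "T (S (proj (range S) x)) = proj (range S) x" for x
    using proj_in range_iff by blast
  then show "S \<circ> proj (range S) \<in> bop UNIV UNIV \<and> T \<circ> (S \<circ> proj (range S)) = proj (range S) \<and>
      range (S \<circ> proj (range S)) \<subseteq> range S"
    using bop_compose [OF S proj_bop] by auto
next
  fix B assume B: "B \<in> bop UNIV UNIV \<and> T \<circ> B = proj (range S) \<and> range B \<subseteq> range S"
  show "B = S \<circ> proj (range S)"
  proof
    fix x
    have "T (B x) = proj (range S) x"
      using B by (metis comp_apply)
    moreover have "T (S (B x)) = B x"
      using B range_iff by blast
    ultimately show "B x = (S \<circ> proj (range S)) x"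
      by (metis commute comp_apply)
  qed
qed

text \<open>The inner projector disappears because it acts on a value of \<open>S\<close>.\<close>

lemma weak_group_eq: "weak_group T x = S (S (proj (range S) (T x)))"
  by (simp add: weak_group_def coreEP_eq proj_ident)

text \<open>The weak group inverse has range \<open>range S\<close>, so the first equation says that
  \<open>T\<close> and \<open>U\<close> agree there. In the second, \<open>S \<circ> S\<close> is
  injective on \<open>range S\<close> and can be cancelled, leaving only the projector and one
  factor \<open>T\<close>.\<close>

lemma weak_group_relation_iff:
  assumes U: "U \<in> bop UNIV UNIV"
  shows "T \<circ> weak_group T = U \<circ> weak_group T \<and> weak_group T \<circ> T = weak_group T \<circ> U \<longleftrightarrow>
    (\<forall>x\<in>range S. T x = U x) \<and> (\<forall>x. proj (range S) (T (T x - U x)) = 0)"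
    (is "?lhs \<longleftrightarrow> ?rhs")
proof
  assume lhs: ?lhs
  have "T x = U x" if "x \<in> range S" for x
  proof -
    have "T x \<in> range S"
      using that by (metis commute range_iff)
    \<comment> \<open>This exhibits every \<open>x\<close> in \<open>range S\<close> as a value of
      the weak group inverse, namely at \<open>T x\<close>.\<close>
    then have "weak_group T (T x) = S (S (T (T x)))"
      using that by (simp add: weak_group_eq proj_ident commute range_iff)
    also have "\<dots> = x"
      using that by (simp add: commute range_iff)
    finally show ?thesis
      using lhs by (metis comp_apply)
  qed
  moreover have "proj (range S) (T (T x - U x)) = 0" for x
  proof -
    let ?p = "proj (range S) (T (T x - U x))"
    have "weak_group T (T x) = weak_group T (U x)"
      using lhs by (metis comp_apply)
    then have "S (S ?p) = 0"
      by (simp add: weak_group_eq bop_diff S T proj_bop)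
    then have "T (T (S (S ?p))) = 0"
      by (simp add: bop_zero T)
    then show "?p = 0"
      using proj_in range_iff by (metis commute)
  qed
  ultimately show ?rhs by blast
next
  assume rhs: ?rhs
  then have "proj (range S) (T (T x)) = proj (range S) (T (U x))" for x
    by (simp add: bop_diff T proj_bop)
  with rhs show ?lhs
    by (auto simp: fun_eq_iff weak_group_eq)
qed

end


section \<open>Weighted inverses\<close>

locale weighted_gDrazin =
  fixes W :: "'b::chilbert_space \<Rightarrow> 'a::chilbert_space" and A D :: "'a \<Rightarrow> 'b"
  assumes W: "W \<in> bop UNIV UNIV" and A: "A \<in> bop UNIV UNIV"
    and WgDrazin_inverse: "is_WgDrazin_inverse W A D"
begin

lemma D: "D \<in> bop UNIV UNIV"
  and commute: "D (W (A x)) = A (W (D x))"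
  and outer: "A (W (D (W (D x)))) = D x"
proof -
  show "D \<in> bop UNIV UNIV"
    using WgDrazin_inverse by (simp add: is_WgDrazin_inverse_def)
  show commute: "D (W (A x)) = A (W (D x))" for x
    using WgDrazin_inverse unfolding is_WgDrazin_inverse_def fun_eq_iff by auto
  have "D (W (A (W (D x)))) = D x"
    using WgDrazin_inverse unfolding is_WgDrazin_inverse_def fun_eq_iff by auto
  then show "A (W (D (W (D x)))) = D x"
    by (simp add: commute)
qed

text \<open>Commutation rewrites \<open>(A - A W D W A) W\<close> as the quasinilpotent part of
  \<open>A W\<close>, so the weighted condition is the unweighted one on \<open>Y\<close>.\<close>

sublocale Y: gDrazin_pair "A \<circ> W" "D \<circ> W"
proof
  show "A \<circ> W \<in> bop UNIV UNIV"
    by (rule bop_compose [OF A W])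
  have "quasinilpotent UNIV ((\<lambda>x. A x - (A \<circ> W \<circ> D \<circ> W \<circ> A) x) \<circ> W)"
    using WgDrazin_inverse unfolding is_WgDrazin_inverse_def by blast
  then show "is_gDrazin_inverse (A \<circ> W) (D \<circ> W)"
    using bop_compose [OF D W] by (simp add: is_gDrazin_inverse_def o_def commute outer)
qed

text \<open>On \<open>X\<close> the quasinilpotent part is \<open>W (A - A W D W A)\<close>, with
  \<open>W\<close> on the other side, so the factors must be swapped first.\<close>

sublocale X: gDrazin_pair "W \<circ> A" "W \<circ> D"
proof
  show "W \<circ> A \<in> bop UNIV UNIV"
    by (rule bop_compose [OF W A])
  have "(\<lambda>x. A x - (A \<circ> W \<circ> D \<circ> W \<circ> A) x) \<in> bop UNIV UNIV"
    by (intro bop_sub bop_compose A W D)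
  moreover have "quasinilpotent UNIV ((\<lambda>x. A x - (A \<circ> W \<circ> D \<circ> W \<circ> A) x) \<circ> W)"
    using WgDrazin_inverse unfolding is_WgDrazin_inverse_def by blast
  ultimately have "quasinilpotent UNIV (W \<circ> (\<lambda>x. A x - (A \<circ> W \<circ> D \<circ> W \<circ> A) x))"
    by (rule quasinilpotent_swap [OF _ W])
  then show "is_gDrazin_inverse (W \<circ> A) (W \<circ> D)"
    using bop_compose [OF W D] by (simp add: is_gDrazin_inverse_def o_def commute outer bop_diff W)
qed

text \<open>\<open>D W A W = A W D W\<close> is the identity on \<open>range (D \<circ> W)\<close>.
  An operator \<open>B\<close> with values there and \<open>W A W B = P\<close> is therefore
  \<open>D W A W B = D P\<close>.\<close>

lemma WcoreEP_eq: "WcoreEP W A = D \<circ> proj (range (W \<circ> D))"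
  unfolding WcoreEP_def X.gDrazin_eq Y.gDrazin_eq
proof (rule the_equality)
  let ?P = "proj (range (W \<circ> D))"
  have "W (A (W (D (?P x)))) = ?P x" for x
    using X.proj_in [of x] unfolding X.range_iff by simp
  moreover have "D x \<in> range (D \<circ> W)" for x
    unfolding Y.range_iff by (simp add: outer)
  ultimately show "D \<circ> ?P \<in> bop UNIV UNIV \<and> W \<circ> A \<circ> W \<circ> (D \<circ> ?P) = ?P \<and>
      range (D \<circ> ?P) \<subseteq> range (D \<circ> W)"
    using bop_compose [OF D X.proj_bop] by (auto simp: fun_eq_iff)
next
  fix B assume B: "B \<in> bop UNIV UNIV \<and> W \<circ> A \<circ> W \<circ> B = proj (range (W \<circ> D)) \<and>
    range B \<subseteq> range (D \<circ> W)"
  show "B = D \<circ> proj (range (W \<circ> D))"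
  proof
    fix x
    have "W (A (W (B x))) = proj (range (W \<circ> D)) x"
      using B by (metis comp_apply)
    moreover have "A (W (D (W (B x)))) = B x"
      using B Y.range_iff [of "B x"] by auto
    ultimately show "B x = (D \<circ> proj (range (W \<circ> D))) x"
      by (metis commute comp_apply)
  qed
qed

text \<open>Both sides are \<open>W D P W D P W A\<close>; this identifies statements (ii) and
  (iii).\<close>

lemma W_comp_Wweak_group: "W \<circ> Wweak_group W A = weak_group (W \<circ> A)"
  by (simp add: Wweak_group_def weak_group_def WcoreEP_eq X.coreEP_eq o_assoc)

end


section \<open>Block matrices\<close>

text \<open>\<open>inv_into U T\<close> agrees with the explicit inverse \<open>S\<close> on
  \<open>V\<close>, which suffices for its boundedness there.\<close>

lemma invertible_bopI:
  assumes "csubspace V" and T: "T \<in> bop U V" and S: "S \<in> bop V U"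
    and ST: "\<And>x. x \<in> U \<Longrightarrow> S (T x) = x" and TS: "\<And>y. y \<in> V \<Longrightarrow> T (S y) = y"
  shows "invertible_bop U V T"
proof -
  have bij: "bij_betw T U V"
    using T S ST TS by (intro bij_betwI [where g = S]) (auto simp: bop_def)
  have "inv_into U T y = S y" if "y \<in> V" for y
    using bij that S TS by (intro inv_into_f_eq) (auto simp: bop_def bij_betw_def)
  then have "inv_into U T \<in> bop V U"
    by (rule bop_cong [OF S \<open>csubspace V\<close>])
  with T bij show ?thesis
    by (simp add: invertible_bop_def)
qed

lemma bop_app_in: "T \<in> bop U V \<Longrightarrow> x \<in> U \<Longrightarrow> T x \<in> V"
  by (simp add: bop_def)

lemma bop_compose_on:
  assumes S: "S \<in> bop V Z" and T: "T \<in> bop U V"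
  shows "S \<circ> T \<in> bop U Z"
proof -
  obtain K where K: "\<And>y. y \<in> V \<Longrightarrow> norm (S y) \<le> norm y * K"
    using S unfolding bop_def by blast
  obtain M where M: "\<And>x. x \<in> U \<Longrightarrow> norm (T x) \<le> norm x * M"
    using T unfolding bop_def by blast
  have "norm (S (T x)) \<le> norm x * (\<bar>M\<bar> * \<bar>K\<bar>)" if "x \<in> U" for x
  proof -
    have "norm (S (T x)) \<le> norm (T x) * \<bar>K\<bar>"
      using K [OF bop_app_in [OF T that]] mult_left_mono [OF abs_ge_self norm_ge_zero] order_trans
      by blast
    also have "norm (T x) \<le> norm x * \<bar>M\<bar>"
      using M [OF that] mult_left_mono [OF abs_ge_self norm_ge_zero] order_trans by blast
    finally show ?thesis
      by (simp add: mult.assoc mult_right_mono)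
  qed
  with S T show ?thesis
    unfolding bop_def by auto
qed

lemma bop_zero_on:
  assumes "T \<in> bop U V" "csubspace U"
  shows "T 0 = 0"
proof -
  have "0 \<in> U"
    using assms(2) by (rule complex_vector.subspace_0)
  then have "T (0 + 0) = T 0 + T 0"
    using assms(1) unfolding bop_def by blast
  then show ?thesis by simp
qed

lemma bop_diff_proj:
  assumes "closed_csubspace V" "T \<in> bop UNIV UNIV"
  shows "(\<lambda>x. T x - proj V (T x)) \<in> bop UNIV UNIV"
  using bop_sub [OF assms(2) bop_compose [OF closed_csubspace.proj_bop [OF assms(1)] assms(2)]]
  by (simp add: o_def)

text \<open>The entries need only agree with the compressions of \<open>T\<close> on their own
  domains, so an entry given by a formula, as in the upper left corner of \<open>B\<close>, can be
  used directly.\<close>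

lemma block_matrix_projI:
  assumes U: "closed_csubspace U" and V: "closed_csubspace V" and T: "T \<in> bop UNIV UNIV"
    and T11: "\<And>x. x \<in> U \<Longrightarrow> T11 x = proj V (T x)"
    and T12: "\<And>x. x \<in> orth U \<Longrightarrow> T12 x = proj V (T x)"
    and T21: "\<And>x. x \<in> U \<Longrightarrow> T21 x = T x - proj V (T x)"
    and T22: "\<And>x. x \<in> orth U \<Longrightarrow> T22 x = T x - proj V (T x)"
  shows "block_matrix U (orth U) V (orth V) T T11 T12 T21 T22"
proof -
  interpret U: closed_csubspace U by fact
  interpret V: closed_csubspace V by fact
  have P: "(\<lambda>x. proj V (T x)) \<in> bop Z V" for Z
    using bop_mono [OF bop_compose [OF V.proj_bop T], of Z V] by (simp add: V.proj_in o_def)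
  have Q: "(\<lambda>x. T x - proj V (T x)) \<in> bop Z (orth V)" for Z
    using bop_diff_proj [OF V T] by (rule bop_mono) (rule V.diff_proj_orth)
  have "T11 \<in> bop U V" "T12 \<in> bop (orth U) V" "T21 \<in> bop U (orth V)" "T22 \<in> bop (orth U) (orth V)"
    using bop_cong [OF P U.csubspace T11] bop_cong [OF P csubspace_orth T12]
      bop_cong [OF Q U.csubspace T21] bop_cong [OF Q csubspace_orth T22] by blast+
  then show ?thesis
    unfolding block_matrix_def
    by (auto simp: U.orthogonal_sum_orth V.orthogonal_sum_orth T11 T12 T21 T22 bop_add T)
qed

lemma block_matrixD:
  assumes "block_matrix U1 U2 V1 V2 T T11 T12 T21 T22"
  shows "x \<in> U1 \<Longrightarrow> T x = T11 x + T21 x" "x \<in> U2 \<Longrightarrow> T x = T12 x + T22 x"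
    and "x \<in> U1 \<Longrightarrow> T11 x \<in> V1" "x \<in> U2 \<Longrightarrow> T12 x \<in> V1"
    and "x \<in> U1 \<Longrightarrow> T21 x \<in> V2" "x \<in> U2 \<Longrightarrow> T22 x \<in> V2"
proof -
  have U: "csubspace U1" "csubspace U2"
    and T: "T11 \<in> bop U1 V1" "T12 \<in> bop U2 V1" "T21 \<in> bop U1 V2" "T22 \<in> bop U2 V2"
    and eq: "\<And>u v. u \<in> U1 \<Longrightarrow> v \<in> U2 \<Longrightarrow> T (u + v) = (T11 u + T12 v) + (T21 u + T22 v)"
    using assms by (auto simp: block_matrix_def orthogonal_sum_def)
  have 0: "0 \<in> U1" "0 \<in> U2" "T11 0 = 0" "T12 0 = 0" "T21 0 = 0" "T22 0 = 0"
    using U T by (blast intro: complex_vector.subspace_0 bop_zero_on)+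
  show "x \<in> U1 \<Longrightarrow> T x = T11 x + T21 x" "x \<in> U2 \<Longrightarrow> T x = T12 x + T22 x"
    using eq [of x 0] eq [of 0 x] 0 by simp_all
  show "x \<in> U1 \<Longrightarrow> T11 x \<in> V1" "x \<in> U2 \<Longrightarrow> T12 x \<in> V1"
    "x \<in> U1 \<Longrightarrow> T21 x \<in> V2" "x \<in> U2 \<Longrightarrow> T22 x \<in> V2"
    using T by (auto intro: bop_app_in)
qed

text \<open>\<open>N\<close> is upper triangular with zero left column and lower right corner
  \<open>K\<close>. The resolvent of \<open>N\<close> leaves \<open>L\<close> invariant, so its
  compression to \<open>orth L\<close> inverts \<open>K - c\<close>.\<close>

lemma (in closed_csubspace) quasinilpotent_corner:
  assumes N: "quasinilpotent UNIV N" and N0: "\<And>x. x \<in> L \<Longrightarrow> N x = 0"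
    and K: "K \<in> bop (orth L) (orth L)" and NK: "\<And>x. x \<in> orth L \<Longrightarrow> N x - K x \<in> L"
  shows "quasinilpotent (orth L) K"
  unfolding quasinilpotent_def
proof (intro conjI K subsetI)
  fix c assume c: "c \<in> spectrum (orth L) K"
  have "invertible_bop (orth L) (orth L) (\<lambda>x. K x - c *\<^sub>C x)" if "c \<noteq> 0"
  proof -
    have Nb: "N \<in> bop UNIV UNIV"
      using N by (simp add: quasinilpotent_def)
    obtain R where R: "R \<in> bop UNIV UNIV" and NR: "\<And>x. N (R x) - c *\<^sub>C R x = x"
      and RN: "\<And>x. R (N x - c *\<^sub>C x) = x"
      using N \<open>c \<noteq> 0\<close> unfolding quasinilpotent_UNIV_iff by blast
    let ?K = "\<lambda>x. K x - c *\<^sub>C x" and ?R = "\<lambda>x. R x - proj L (R x)"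
    have Nc: "(\<lambda>x. (N x - c *\<^sub>C x) - proj L (N x - c *\<^sub>C x)) \<in> bop UNIV UNIV"
      using bop_diff_proj [OF closed_csubspace_axioms bop_sub [OF Nb bop_scale [OF bop_ident]]] .
    have K_eq: "K x - c *\<^sub>C x = (N x - c *\<^sub>C x) - proj L (N x - c *\<^sub>C x)" if "x \<in> orth L" for x
    proof -
      have "proj L (N x - c *\<^sub>C x) = N x - K x"
      proof (rule proj_eqI [OF csubspace NK [OF that]])
        have "K x - c *\<^sub>C x \<in> orth L"
          using that K csubspace_orth
          by (intro complex_vector.subspace_diff complex_vector.subspace_scale) (auto intro: bop_app_in)
        then show "N x - c *\<^sub>C x - (N x - K x) \<in> orth L"
          by (simp add: algebra_simps)
      qed
      then show ?thesis by (simp add: algebra_simps)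
    qed
    show ?thesis
    proof (rule invertible_bopI [OF csubspace_orth])
      show "?K \<in> bop (orth L) (orth L)"
        by (rule bop_cong [OF bop_mono [OF Nc] csubspace_orth K_eq]) (rule diff_proj_orth)
      show "?R \<in> bop (orth L) (orth L)"
        using bop_diff_proj [OF closed_csubspace_axioms R] by (rule bop_mono) (rule diff_proj_orth)
    next
      fix x assume x: "x \<in> orth L"
      \<comment> \<open>On \<open>L\<close> the operator \<open>N - c\<close> is multiplication by
        \<open>- c\<close>, so \<open>R\<close> acts there as \<open>- 1/c\<close>; thus
        \<open>R ?l\<close> stays in \<open>L\<close> and the compression discards it.\<close>
      let ?l = "proj L (N x - c *\<^sub>C x)"
      have l: "N ?l = 0"
        by (rule N0 [OF proj_in])
      have "R (- c *\<^sub>C ?l) = ?l"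
        using RN [of ?l] l by simp
      then have "c *\<^sub>C R ?l = - ?l"
        by (simp add: bop_minus bop_scaleC R minus_equation_iff)
      then have "inverse c *\<^sub>C c *\<^sub>C R ?l = inverse c *\<^sub>C - ?l"
        by simp
      then have "R ?l = inverse c *\<^sub>C - ?l"
        using \<open>c \<noteq> 0\<close> by (simp add: scaleC_scaleC scaleC_one)
      then have "proj L (R ?l) = R ?l"
        by (simp add: proj_ident proj_in csubspace complex_vector.subspace_scale complex_vector.subspace_neg)
      moreover have "R (?K x) = x - R ?l"
        by (simp only: K_eq [OF x] bop_diff [OF R, of "N x - c *\<^sub>C x"] RN)
      ultimately show "?R (?K x) = x"
        by (simp add: bop_diff proj_bop proj_orth x)
    next
      fix y assume y: "y \<in> orth L"
      \<comment> \<open>Dropping the \<open>L\<close>-component of \<open>R y\<close> does not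
        affect \<open>N\<close>, and changes the \<open>c\<close> term only by a vector of
        \<open>L\<close>, which the projection in \<open>K_eq\<close> removes.\<close>
      let ?z = "R y"
      have "N (?R y) = N ?z"
        by (simp add: bop_diff Nb N0 proj_in)
      then have "N (?R y) - c *\<^sub>C ?R y = y + c *\<^sub>C proj L ?z"
        using NR [of y] by (simp add: complex_vector.scale_right_diff_distrib algebra_simps)
      moreover have "proj L (y + c *\<^sub>C proj L ?z) = c *\<^sub>C proj L ?z"
        by (simp add: bop_add bop_scaleC proj_bop proj_orth y proj_ident proj_in)
      ultimately show "?K (?R y) = y"
        by (simp add: K_eq diff_proj_orth)
    qed
  qed
  with c show "c \<in> {0}"
    by (auto simp: spectrum_def)
qed

text \<open>The operator \<open>T - T T S\<close> vanishes on \<open>range S\<close> and differs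
  from \<open>T\<close> by values in \<open>range S\<close>, so it has the same lower right corner
  as \<open>T\<close>.\<close>

lemma (in gDrazin_pair) quasinilpotent_corner:
  assumes K: "K \<in> bop (orth (range S)) (orth (range S))"
    and TK: "\<And>x. x \<in> orth (range S) \<Longrightarrow> T x - K x \<in> range S"
  shows "quasinilpotent (orth (range S)) K"
proof (rule quasinilpotent_corner [OF quasinilpotent _ K])
  show "T x - T (T (S x)) = 0" if "x \<in> range S" for x
    using that by (simp add: range_iff)
  show "T x - T (T (S x)) - K x \<in> range S" if "x \<in> orth (range S)" for x
  proof -
    have "T (T (S x)) \<in> range S"
      by (metis commute rangeI)
    then have "T x - K x - T (T (S x)) \<in> range S"
      by (rule complex_vector.subspace_diff [OF csubspace TK [OF that]])
    then show ?thesis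
      by (simp add: algebra_simps)
  qed
qed

lemma (in closed_csubspace) decompose: "\<exists>u\<in>L. \<exists>v\<in>orth L. x = u + v"
  using orthogonal_sum_orth by (simp add: orthogonal_sum_def)

lemma (in closed_csubspace) add_orth_eq_iff:
  assumes "u \<in> L" "v \<in> orth L" "w \<in> L"
  shows "u + v = w \<longleftrightarrow> u = w \<and> v = 0"
proof
  assume "u + v = w"
  then have "proj L (u + v) = proj L w" by simp
  then have "u = w"
    using assms by (simp add: bop_add proj_bop proj_ident proj_orth)
  with \<open>u + v = w\<close> show "u = w \<and> v = 0" by simp
qed simp

section \<open>Invertible upper left corners of \<open>A\<close> and \<open>W\<close>, with explicit
  inverses\<close>

context weighted_gDrazin
begin

definition X1 where "X1 = range (W \<circ> D)"
definition Y1 where "Y1 = range (D \<circ> W)"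

sublocale X1: closed_csubspace X1
  unfolding X1_def by (rule X.closed_csubspace_axioms)

sublocale Y1: closed_csubspace Y1
  unfolding Y1_def by (rule Y.closed_csubspace_axioms)

lemma X1_iff: "x \<in> X1 \<longleftrightarrow> W (A (W (D x))) = x"
  unfolding X1_def X.range_iff by simp

lemma Y1_iff: "y \<in> Y1 \<longleftrightarrow> A (W (D (W y))) = y"
  unfolding Y1_def Y.range_iff by simp

lemma A_in: "x \<in> X1 \<Longrightarrow> A x \<in> Y1"
  by (simp add: X1_iff Y1_iff commute)

lemma W_in: "y \<in> Y1 \<Longrightarrow> W y \<in> X1"
  by (simp add: X1_iff Y1_iff)

lemma D_in: "D x \<in> Y1"
  by (simp add: Y1_iff outer)

text \<open>Stated for any \<open>W1\<close> agreeing with \<open>W\<close> on \<open>Y1\<close>,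
  since a block entry is determined only on its domain.\<close>

lemma inv_into_W:
  assumes "\<And>y. y \<in> Y1 \<Longrightarrow> W1 y = W y" "x \<in> X1"
  shows "inv_into Y1 W1 x = A (W (D x))"
proof (rule inv_into_f_eq)
  show "inj_on W1 Y1"
    using assms(1) by (intro inj_onI) (metis Y1_iff)
  show in_Y1: "A (W (D x)) \<in> Y1"
    by (simp add: A_in W_in D_in)
  show "W1 (A (W (D x))) = x"
    using assms(2) by (simp add: assms(1) [OF in_Y1] X1_iff)
qed

text \<open>On \<open>X1\<close> the weighted inverse \<open>D\<close> itself inverts
  \<open>W A W\<close> restricted to \<open>Y1\<close>.\<close>

lemma inv_into_WAW:
  assumes "\<And>y. y \<in> Y1 \<Longrightarrow> V y = W (A (W y))" "x \<in> X1"
  shows "inv_into Y1 V x = D x"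
proof (rule inv_into_f_eq)
  show "inj_on V Y1"
    using assms(1) by (intro inj_onI) (metis Y1_iff commute)
  show "D x \<in> Y1"
    by (rule D_in)
  show "V (D x) = x"
    using assms(2) by (simp add: assms(1) [OF D_in] X1_iff)
qed

lemma invertible_A: "invertible_bop X1 Y1 A"
proof (rule invertible_bopI [OF Y1.csubspace])
  show "A \<in> bop X1 Y1"
    by (rule bop_mono [OF A A_in])
  have "(\<lambda>y. W (D (W y))) \<in> bop UNIV UNIV"
    using bop_compose [OF W bop_compose [OF D W]] by (simp add: o_def)
  then show "(\<lambda>y. W (D (W y))) \<in> bop Y1 X1"
    by (rule bop_mono) (rule W_in [OF D_in])
qed (simp_all add: X1_iff Y1_iff commute)

lemma invertible_W: "invertible_bop Y1 X1 W"
proof (rule invertible_bopI [OF X1.csubspace])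
  show "W \<in> bop Y1 X1"
    by (rule bop_mono [OF W W_in])
  have "(\<lambda>x. A (W (D x))) \<in> bop UNIV UNIV"
    using bop_compose [OF A bop_compose [OF W D]] by (simp add: o_def)
  then show "(\<lambda>x. A (W (D x))) \<in> bop X1 Y1"
    by (rule bop_mono) (rule A_in [OF W_in [OF D_in]])
qed (simp_all add: X1_iff Y1_iff)

end

text \<open>The entries are arbitrary, so the results apply both to the compressions chosen in the
  forward direction and to the given blocks in the converse.\<close>

locale weighted_blocks = weighted_gDrazin W A D
  for W :: "'b::chilbert_space \<Rightarrow> 'a::chilbert_space" and A D +
  fixes A1 A2 A3 W1 W2 W3
  assumes A_blocks: "block_matrix X1 (orth X1) Y1 (orth Y1) A A1 A2 (\<lambda>x. 0) A3"
    and W_blocks: "block_matrix Y1 (orth Y1) X1 (orth X1) W W1 W2 (\<lambda>y. 0) W3"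
begin

lemma A1: "x \<in> X1 \<Longrightarrow> A1 x = A x"
  and A2_in: "x \<in> orth X1 \<Longrightarrow> A2 x \<in> Y1"
  and A3_in: "x \<in> orth X1 \<Longrightarrow> A3 x \<in> orth Y1"
  and A_split: "x \<in> orth X1 \<Longrightarrow> A x = A2 x + A3 x"
  using block_matrixD [OF A_blocks] by auto

lemma W1: "y \<in> Y1 \<Longrightarrow> W1 y = W y"
  and W2_in: "y \<in> orth Y1 \<Longrightarrow> W2 y \<in> X1"
  and W3_in: "y \<in> orth Y1 \<Longrightarrow> W3 y \<in> orth X1"
  and W_split: "y \<in> orth Y1 \<Longrightarrow> W y = W2 y + W3 y"
  using block_matrixD [OF W_blocks] by auto

text \<open>The product of the triangular matrices has lower right corner
  \<open>W3 \<circ> A3\<close>; the remaining terms of its right column lie in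
  \<open>X1\<close>.\<close>

lemma quasinilpotent_W3_A3: "quasinilpotent (orth X1) (W3 \<circ> A3)"
proof (rule X.quasinilpotent_corner [folded X1_def])
  show "W3 \<circ> A3 \<in> bop (orth X1) (orth X1)"
    using A_blocks W_blocks by (auto simp: block_matrix_def intro: bop_compose_on)
  fix x assume x: "x \<in> orth X1"
  have "(W \<circ> A) x - (W3 \<circ> A3) x = W (A2 x) + W2 (A3 x)"
    by (simp add: A_split x bop_add W W_split A3_in)
  then show "(W \<circ> A) x - (W3 \<circ> A3) x \<in> X1"
    by (simp add: complex_vector.subspace_add X1.csubspace W_in A2_in W2_in A3_in x)
qed

lemma quasinilpotent_A3_W3: "quasinilpotent (orth Y1) (A3 \<circ> W3)"
proof (rule Y.quasinilpotent_corner [folded Y1_def])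
  show "A3 \<circ> W3 \<in> bop (orth Y1) (orth Y1)"
    using A_blocks W_blocks by (auto simp: block_matrix_def intro: bop_compose_on)
  fix y assume y: "y \<in> orth Y1"
  have "(A \<circ> W) y - (A3 \<circ> W3) y = A (W2 y) + A2 (W3 y)"
    by (simp add: W_split y bop_add A A_split W3_in)
  then show "(A \<circ> W) y - (A3 \<circ> W3) y \<in> Y1"
    by (simp add: complex_vector.subspace_add Y1.csubspace A_in W2_in A2_in W3_in y)
qed

text \<open>The component in \<open>orth X1\<close> of the equation is \<open>W3 b4 = 0\<close>; the
  one in \<open>X1\<close> is solved for \<open>b1\<close> by inverting \<open>W\<close> on
  \<open>Y1\<close>.\<close>

lemma left_column_iff:
  assumes x: "x \<in> X1" and b1: "b1 \<in> Y1" and b4: "b4 \<in> orth Y1"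
  shows "W (A x) = W (b1 + b4) \<longleftrightarrow> W3 b4 = 0 \<and> b1 = A1 x - inv_into Y1 W1 (W2 b4)"
proof -
  \<comment> \<open>The preimage of \<open>W2 b4\<close> under \<open>W\<close> in
    \<open>Y1\<close>, used to absorb \<open>W2 b4\<close> into the argument of
    \<open>W\<close>.\<close>
  let ?e = "A (W (D (W2 b4)))"
  have e: "?e \<in> Y1" "W ?e = W2 b4"
    using W2_in [OF b4] by (simp_all add: A_in W_in D_in flip: X1_iff)
  have "W (b1 + b4) = W (b1 + ?e) + W3 b4"
    by (simp add: bop_add W e W_split b4)
  moreover have b1e: "b1 + ?e \<in> Y1"
    by (simp add: complex_vector.subspace_add Y1.csubspace b1 e)
  ultimately have "W (A x) = W (b1 + b4) \<longleftrightarrow> W (b1 + ?e) = W (A x) \<and> W3 b4 = 0"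
    using X1.add_orth_eq_iff [of "W (b1 + ?e)" "W3 b4" "W (A x)"] x b4
    by (metis A_in W3_in W_in)
  also have "W (b1 + ?e) = W (A x) \<longleftrightarrow> b1 + ?e = A x"
    using b1e A_in [OF x] by (metis Y1_iff)
  also have "\<dots> \<longleftrightarrow> b1 = A1 x - inv_into Y1 W1 (W2 b4)"
    by (simp add: A1 x inv_into_W [OF W1] W2_in b4 eq_diff_eq)
  finally show ?thesis by blast
qed

text \<open>Here \<open>d2\<close> and \<open>d3\<close> stand for the right column of
  \<open>A - B\<close>, and \<open>q\<close> is the \<open>X1\<close>-component of
  \<open>W A W3 d3\<close>. Applying \<open>D\<close>, the inverse of \<open>W A W\<close> from
  \<open>X1\<close> to \<open>Y1\<close>, to the projected vector produces the three
  summands.\<close>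

lemma right_column_iff:
  assumes d2: "d2 \<in> Y1" and d3: "d3 \<in> orth Y1"
  defines "q \<equiv> W1 (A2 (W3 d3)) + W2 (A3 (W3 d3))"
  shows "proj X1 (W (A (W (d2 + d3)))) = 0 \<longleftrightarrow>
    d2 + inv_into Y1 W1 (W2 d3) + inv_into Y1 (W1 \<circ> A1 \<circ> W1) q = 0"
proof -
  let ?z = "W3 d3"
  let ?w = "W (A (W d2)) + W (A (W2 d3)) + q"
  have z: "?z \<in> orth X1"
    by (rule W3_in [OF d3])
  have q: "q \<in> X1" "W (A ?z) = q + W3 (A3 ?z)"
    unfolding q_def using z
    by (simp_all add: A_split bop_add W W_split A3_in A2_in W1 W2_in W_in
        complex_vector.subspace_add X1.csubspace)
  have w: "?w \<in> X1"
    by (simp add: complex_vector.subspace_add X1.csubspace q W_in A_in W2_in d2 d3)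
  have "W (A (W (d2 + d3))) = ?w + W3 (A3 ?z)"
    by (simp add: bop_add W A W_split d3 q)
  then have "proj X1 (W (A (W (d2 + d3)))) = ?w"
    using X1.proj_ident [OF w] X1.proj_orth [OF W3_in [OF A3_in [OF z]]]
    by (simp add: bop_add [OF X1.proj_bop, of ?w])
  \<comment> \<open>\<open>D\<close> is injective on \<open>X1\<close>, because
    \<open>W A W D\<close> is the identity there.\<close>
  moreover have "?w = 0 \<longleftrightarrow> D ?w = 0"
    using w by (metis W A X1_iff bop_zero D)
  moreover have "D ?w = d2 + A (W (D (W2 d3))) + D q"
    using d2 by (simp add: bop_add D commute Y1_iff)
  moreover have "inv_into Y1 W1 (W2 d3) = A (W (D (W2 d3)))"
    by (intro inv_into_W W1 W2_in d3)
  moreover have "inv_into Y1 (W1 \<circ> A1 \<circ> W1) q = D q"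
    by (intro inv_into_WAW q) (simp add: W1 A1 W_in A_in)
  ultimately show ?thesis by simp
qed

end

section \<open>Equivalence of the operator equations with the block form\<close>

context weighted_gDrazin
begin

lemma weak_group_relation_iff_blocks:
  assumes B: "B \<in> bop UNIV UNIV"
  shows "(\<forall>x\<in>X1. (W \<circ> A) x = (W \<circ> B) x) \<and>
      (\<forall>x. proj X1 ((W \<circ> A) ((W \<circ> A) x - (W \<circ> B) x)) = 0) \<longleftrightarrow>
    (\<exists>A1 A2 A3 W1 W2 W3 B2 B3 B4.
       block_matrix X1 (orth X1) Y1 (orth Y1) A A1 A2 (\<lambda>x. 0) A3 \<and>
       block_matrix Y1 (orth Y1) X1 (orth X1) W W1 W2 (\<lambda>y. 0) W3 \<and>
       block_matrix X1 (orth X1) Y1 (orth Y1) B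
         (\<lambda>x. A1 x - inv_into Y1 W1 (W2 (B4 x))) B2 B4 B3 \<and>
       invertible_bop X1 Y1 A1 \<and> invertible_bop Y1 X1 W1 \<and>
       (\<forall>x\<in>X1. W3 (B4 x) = 0) \<and>
       (\<forall>x\<in>orth X1. B2 x = A2 x + inv_into Y1 W1 (W2 (A3 x - B3 x))
          + inv_into Y1 (W1 \<circ> A1 \<circ> W1)
              (let z = W3 (A3 x - B3 x) in W1 (A2 z) + W2 (A3 z))) \<and>
       quasinilpotent (orth Y1) (A3 \<circ> W3) \<and> quasinilpotent (orth X1) (W3 \<circ> A3))"
    (is "?L \<longleftrightarrow> ?R")
proof
  assume ?L
  then have left: "\<And>x. x \<in> X1 \<Longrightarrow> W (A x) = W (B x)"
    and right: "\<And>x. proj X1 (W (A (W (A x) - W (B x)))) = 0"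
    by auto
  \<comment> \<open>The witnesses are compressions by the projectors; \<open>A\<close> and
    \<open>W\<close> serve as their own upper left corners because they map \<open>X1\<close> and
    \<open>Y1\<close> into each other.\<close>
  let ?A2 = "\<lambda>x. proj Y1 (A x)" and ?A3 = "\<lambda>x. A x - proj Y1 (A x)"
  let ?W2 = "\<lambda>y. proj X1 (W y)" and ?W3 = "\<lambda>y. W y - proj X1 (W y)"
  let ?B2 = "\<lambda>x. proj Y1 (B x)" and ?B3 = "\<lambda>x. B x - proj Y1 (B x)"
  note closed = X1.closed_csubspace_axioms Y1.closed_csubspace_axioms
  have A_blocks: "block_matrix X1 (orth X1) Y1 (orth Y1) A A ?A2 (\<lambda>x. 0) ?A3"
    by (rule block_matrix_projI [OF closed A]) (simp_all add: Y1.proj_ident A_in)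
  have W_blocks: "block_matrix Y1 (orth Y1) X1 (orth X1) W W ?W2 (\<lambda>y. 0) ?W3"
    by (rule block_matrix_projI [OF closed(2,1) W]) (simp_all add: X1.proj_ident W_in)
  interpret weighted_blocks W A D A ?A2 ?A3 W ?W2 ?W3
    by unfold_locales (fact A_blocks W_blocks)+
  have column1: "?W3 (?B3 x) = 0 \<and> ?B2 x = A x - inv_into Y1 W (?W2 (?B3 x))" if "x \<in> X1" for x
  proof -
    have "?B2 x + ?B3 x = B x"
      by simp
    then show ?thesis
      using left_column_iff [OF that Y1.proj_in Y1.diff_proj_orth, of "B x" "B x"] left [OF that]
      by (simp only: simp_thms)
  qed
  have column2: "?B2 x = ?A2 x + inv_into Y1 W (?W2 (?A3 x - ?B3 x))
      + inv_into Y1 (W \<circ> A \<circ> W) (let z = ?W3 (?A3 x - ?B3 x) in W (?A2 z) + ?W2 (?A3 z))"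
    if "x \<in> orth X1" for x
  proof -
    have "?A2 x - ?B2 x \<in> Y1" "?A3 x - ?B3 x \<in> orth Y1"
      by (simp_all add: complex_vector.subspace_diff Y1.csubspace csubspace_orth Y1.proj_in Y1.diff_proj_orth)
    moreover have "W (A (W ((?A2 x - ?B2 x) + (?A3 x - ?B3 x)))) = W (A (W (A x) - W (B x)))"
      by (simp add: bop_diff W)
    then have "proj X1 (W (A (W ((?A2 x - ?B2 x) + (?A3 x - ?B3 x))))) = 0"
      by (simp only: right)
    ultimately have "(?A2 x - ?B2 x) + inv_into Y1 W (?W2 (?A3 x - ?B3 x))
      + inv_into Y1 (W \<circ> A \<circ> W) (W (?A2 (?W3 (?A3 x - ?B3 x))) + ?W2 (?A3 (?W3 (?A3 x - ?B3 x)))) = 0"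
      using right_column_iff by blast
    moreover have "b = a + e + v" if "(a - b) + e + v = 0" for a b e v :: 'b
    proof -
      have "a + e + v - b = (a - b) + e + v"
        by (simp add: algebra_simps)
      with that show ?thesis by simp
    qed
    ultimately show ?thesis
      unfolding Let_def by blast
  qed
  \<comment> \<open>\<open>?B3\<close> serves as \<open>B4\<close> on \<open>X1\<close> and as
    \<open>B3\<close> on \<open>orth X1\<close>. The upper left entry is the required formula, which
    equals the compression by \<open>column1\<close>.\<close>
  have B_blocks: "block_matrix X1 (orth X1) Y1 (orth Y1) B
      (\<lambda>x. A x - inv_into Y1 W (?W2 (?B3 x))) ?B2 ?B3 ?B3"
  proof (rule block_matrix_projI [OF closed B])
    show "A x - inv_into Y1 W (?W2 (?B3 x)) = ?B2 x" if "x \<in> X1" for x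
      by (rule column1 [OF that, THEN conjunct2, symmetric])
  qed (rule refl)+
  show ?R
  proof (intro exI conjI ballI)
    show "?W3 (?B3 x) = 0" if "x \<in> X1" for x
      by (rule column1 [OF that, THEN conjunct1])
  qed (fact A_blocks W_blocks B_blocks invertible_A invertible_W column2
      quasinilpotent_A3_W3 quasinilpotent_W3_A3)+
next
  assume ?R
  then obtain A1 A2 A3 W1 W2 W3 B2 B3 B4 where
    blocks: "block_matrix X1 (orth X1) Y1 (orth Y1) A A1 A2 (\<lambda>x. 0) A3"
      "block_matrix Y1 (orth Y1) X1 (orth X1) W W1 W2 (\<lambda>y. 0) W3"
    and B_blocks: "block_matrix X1 (orth X1) Y1 (orth Y1) B
         (\<lambda>x. A1 x - inv_into Y1 W1 (W2 (B4 x))) B2 B4 B3"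
    and W3_B4: "\<And>x. x \<in> X1 \<Longrightarrow> W3 (B4 x) = 0"
    and B2: "\<And>x. x \<in> orth X1 \<Longrightarrow> B2 x = A2 x + inv_into Y1 W1 (W2 (A3 x - B3 x))
          + inv_into Y1 (W1 \<circ> A1 \<circ> W1)
              (let z = W3 (A3 x - B3 x) in W1 (A2 z) + W2 (A3 z))"
    by (elim exE conjE) blast
  interpret weighted_blocks W A D A1 A2 A3 W1 W2 W3
    by unfold_locales (fact blocks)+
  note B_D = block_matrixD [OF B_blocks]
  have left: "W (A x) = W (B x)" if "x \<in> X1" for x
    using left_column_iff [OF that B_D(3) [OF that] B_D(5) [OF that]] W3_B4 [OF that] B_D(1) [OF that]
    by simp
  have right: "proj X1 (W (A (W (A x - B x)))) = 0" if "x \<in> orth X1" for x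
  proof -
    have "A2 x - B2 x \<in> Y1" "A3 x - B3 x \<in> orth Y1"
      using that by (simp_all add: complex_vector.subspace_diff Y1.csubspace csubspace_orth A2_in A3_in B_D)
    then have "proj X1 (W (A (W ((A2 x - B2 x) + (A3 x - B3 x))))) = 0"
      by (simp add: right_column_iff B2 [OF that] Let_def)
    moreover have "A x - B x = (A2 x - B2 x) + (A3 x - B3 x)"
      by (simp add: A_split [OF that] B_D(2) [OF that])
    ultimately show ?thesis by simp
  qed
  have "proj X1 (W (A (W (A x) - W (B x)))) = 0" for x
  proof -
    obtain u v where uv: "u \<in> X1" "v \<in> orth X1" "x = u + v"
      using X1.decompose by blast
    \<comment> \<open>The part of \<open>x\<close> in \<open>X1\<close> contributes nothing by the
      left column, so the right column decides.\<close>
    have "W (A x) - W (B x) = (W (A u) - W (B u)) + W (A v - B v)"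
      by (simp add: uv(3) bop_add bop_diff W A B)
    also have "\<dots> = W (A v - B v)"
      by (simp add: left uv(1))
    finally show ?thesis
      using right [OF uv(2)] by simp
  qed
  with left show ?L by simp
qed

end

theorem theorem3p2:
  fixes W :: "'y::chilbert_space \<Rightarrow> 'x::chilbert_space"
    and A B :: "'x \<Rightarrow> 'y"
  assumes "infinite_dimensional (UNIV :: 'x set)"
    and "infinite_dimensional (UNIV :: 'y set)"
    and "W \<in> bop UNIV UNIV" and "W \<noteq> (\<lambda>y. 0)"
    and "A \<in> bop UNIV UNIV" and "WgDrazin_invertible W A"
    and "B \<in> bop UNIV UNIV"
  shows
    "let
       i = Wwg_le_l W A B;
       ii = (W \<circ> A \<circ> weak_group (W \<circ> A) = W \<circ> B \<circ> weak_group (W \<circ> A) \<and>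
             weak_group (W \<circ> A) \<circ> W \<circ> A = weak_group (W \<circ> A) \<circ> W \<circ> B);
       iii = (W \<circ> A \<circ> W \<circ> Wweak_group W A = W \<circ> B \<circ> W \<circ> Wweak_group W A \<and>
              W \<circ> Wweak_group W A \<circ> W \<circ> A = W \<circ> Wweak_group W A \<circ> W \<circ> B);
       X1 = range (gDrazin (W \<circ> A)); X2 = null_space (adj (gDrazin (W \<circ> A)));
       Y1 = range (gDrazin (A \<circ> W)); Y2 = null_space (adj (gDrazin (A \<circ> W)));
       iv = (\<exists>A1 A2 A3 W1 W2 W3 B2 B3 B4.
               block_matrix X1 X2 Y1 Y2 A A1 A2 (\<lambda>x. 0) A3 \<and>
               block_matrix Y1 Y2 X1 X2 W W1 W2 (\<lambda>y. 0) W3 \<and>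
               block_matrix X1 X2 Y1 Y2 B
                 (\<lambda>x. A1 x - inv_into Y1 W1 (W2 (B4 x))) B2 B4 B3 \<and>
               invertible_bop X1 Y1 A1 \<and> invertible_bop Y1 X1 W1 \<and>
               (\<forall>x\<in>X1. W3 (B4 x) = 0) \<and>
               (\<forall>x\<in>X2. B2 x = A2 x + inv_into Y1 W1 (W2 (A3 x - B3 x))
                  + inv_into Y1 (W1 \<circ> A1 \<circ> W1)
                      (let z = W3 (A3 x - B3 x) in W1 (A2 z) + W2 (A3 z))) \<and>
               quasinilpotent Y2 (A3 \<circ> W3) \<and> quasinilpotent X2 (W3 \<circ> A3))
     in (i \<longleftrightarrow> ii) \<and> (ii \<longleftrightarrow> iii) \<and> (iii \<longleftrightarrow> iv)"
proof -
  obtain D where "is_WgDrazin_inverse W A D"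
    using assms(6) by (auto simp: WgDrazin_invertible_def)
  then interpret weighted_gDrazin W A D
    using assms(3,5) by unfold_locales
  let ?G = "weak_group (W \<circ> A)"
  \<comment> \<open>The weak group relation of \<open>W \<circ> A\<close> and
    \<open>W \<circ> B\<close>, bracketed as in \<open>weak_group_relation_iff\<close>; (i), (ii)
    and (iii) each reduce to it.\<close>
  let ?rel = "(W \<circ> A) \<circ> ?G = (W \<circ> B) \<circ> ?G \<and> ?G \<circ> (W \<circ> A) = ?G \<circ> (W \<circ> B)"
  have WB: "W \<circ> B \<in> bop UNIV UNIV"
    by (rule bop_compose [OF W assms(7)])
  have i: "Wwg_le_l W A B \<longleftrightarrow> ?rel"
    using assms(6,7) WB X.gDrazin_invertible by (simp add: Wwg_le_l_def wg_le_def)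
  have ii: "(W \<circ> A \<circ> ?G = W \<circ> B \<circ> ?G \<and> ?G \<circ> W \<circ> A = ?G \<circ> W \<circ> B) \<longleftrightarrow> ?rel"
    by (simp only: o_assoc)
  have iii: "(W \<circ> A \<circ> W \<circ> Wweak_group W A = W \<circ> B \<circ> W \<circ> Wweak_group W A \<and>
      W \<circ> Wweak_group W A \<circ> W \<circ> A = W \<circ> Wweak_group W A \<circ> W \<circ> B) \<longleftrightarrow> ?rel"
    by (simp only: comp_assoc flip: W_comp_Wweak_group)
  note iv = weak_group_relation_iff_blocks
    [OF assms(7), unfolded X1_def Y1_def, folded X.weak_group_relation_iff [OF WB]]
  show ?thesis
    unfolding Let_def X.gDrazin_eq Y.gDrazin_eq null_space_adj [OF X.S] null_space_adj [OF Y.S] i ii iii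
    by (intro conjI refl) (rule iv [unfolded Let_def])
qed

end
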